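(* Let $G$ be a connected subcubic graph. Then $i(G)=3\rho(G)$ if and only if $G$ is isomorphic to one of the four graphs $H_1,H_2,H_3,H_4$, where: $H_1$ is the graph on vertices $p_1,\dots,p_8$ whose edges are those of the $8$-cycle $p_1p_2\cdots p_8p_1$ together with the chords $p_1p_3$, $p_2p_6$, $p_4p_7$, $p_5p_8$; $H_2$ is the complete bipartite graph $K_{3,3}$; $H_3$ is the graph on vertices $p_1,\dots,p_8$ whose edges are those of the $8$-cycle $p_1p_2\cdots p_8p_1$ together with the chords $p_1p_5$, $p_2p_6$, $p_3p_7$, $p_4p_8$ (the Wagner graph); $H_4$ is the Petersen graph, i.e. the graph on vertices $p_1,\dots,p_5,q_1,\dots,q_5$ with edges $p_jp_{j+1}$, $p_jq_j$ and $q_jq_{j+2}$ for $j=1,\dots,5$ (indices modulo $5$).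
   Context: All graphs are finite, simple and undirected. A graph is subcubic if its maximum degree is at most $3$. An independent dominating set of $G$ is a set of pairwise non-adjacent vertices such that every vertex of $G$ is in the set or adjacent to a vertex of it; $i(G)$ is the minimum size of an independent dominating set of $G$. A packing of $G$ is a set $S$ of vertices such that every two distinct vertices of $S$ are at distance at least $3$ in $G$; $\rho(G)$ is the maximum size of a packing of $G$. *)

theory Defs
  imports "Graph_Theory.Graph_Theory"
begin

text \<open>
  A finite simple undirected graph is a \<^locale>\<open>pair_graph\<close>: every edge is represented by its
  two opposite arcs. The library's \<^const>\<open>connected\<close> includes that there is a vertex.
\<close>

text \<open>As the arc relation is symmetric, the degree of a vertex is its out-degree.\<close>

definition subcubic :: "'a pair_pre_digraph \<Rightarrow> bool" where
  "subcubic G \<longleftrightarrow> (\<forall>v \<in> pverts G. out_degree (with_proj G) v \<le> 3)"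

text \<open>With unit weights, the shortest-path cost is the distance (infinite if there is no path).\<close>

definition distance :: "'a pair_pre_digraph \<Rightarrow> 'a \<Rightarrow> 'a \<Rightarrow> ereal" where
  "distance G u v = wf_digraph.\<mu> (with_proj G) (\<lambda>_. 1) u v"

definition independent_dominating_set :: "'a pair_pre_digraph \<Rightarrow> 'a set \<Rightarrow> bool" where
  "independent_dominating_set G S \<longleftrightarrow> S \<subseteq> pverts G
     \<and> pairwise (\<lambda>u v. (u, v) \<notin> parcs G) S
     \<and> (\<forall>v \<in> pverts G. v \<in> S \<or> (\<exists>u \<in> S. (u, v) \<in> parcs G))"

definition packing :: "'a pair_pre_digraph \<Rightarrow> 'a set \<Rightarrow> bool" where
  "packing G S \<longleftrightarrow> S \<subseteq> pverts G \<and> pairwise (\<lambda>u v. distance G u v \<ge> 3) S"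

text \<open>
  In a finite graph both sets of cardinalities below are finite and nonempty, so that the
  minimum and the maximum are attained.
\<close>

definition independent_domination_number :: "'a pair_pre_digraph \<Rightarrow> nat" where
  "independent_domination_number G = Min (card ` {S. independent_dominating_set G S})"

definition packing_number :: "'a pair_pre_digraph \<Rightarrow> nat" where
  "packing_number G = Max (card ` {S. packing G S})"

definition undirected :: "'a set \<Rightarrow> 'a rel \<Rightarrow> 'a pair_pre_digraph" where
  "undirected V E = \<lparr> pverts = V, parcs = E \<union> E\<inverse> \<rparr>"

definition cycle8 :: "nat rel" where
  "cycle8 = {(1,2), (2,3), (3,4), (4,5), (5,6), (6,7), (7,8), (8,1)}"

definition H1 :: "nat pair_pre_digraph" where
  "H1 = undirected {1..8} (cycle8 \<union> {(1,3), (2,6), (4,7), (5,8)})"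

definition H2 :: "nat pair_pre_digraph" where
  "H2 = undirected {1..6} ({1..3} \<times> {4..6})"

definition H3 :: "nat pair_pre_digraph" where
  "H3 = undirected {1..8} (cycle8 \<union> {(1,5), (2,6), (3,7), (4,8)})"

text \<open>
  The Petersen graph: \<open>Inl j\<close> is the vertex \<open>p\<^sub>j\<close> of the outer cycle and \<open>Inr j\<close> the vertex
  \<open>q\<^sub>j\<close> of the inner one. Indices are residues modulo 5, so 0 plays the role of 5.
\<close>

definition H4 :: "(nat + nat) pair_pre_digraph" where
  "H4 = undirected ({..<5} <+> {..<5})
     (\<Union>j<5. {(Inl j, Inl ((j + 1) mod 5)), (Inl j, Inr j), (Inr j, Inr ((j + 2) mod 5))})"

lemma pair_graph_undirected:
  assumes "finite V" and "E \<subseteq> V \<times> V" and "irrefl E"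
  shows "pair_graph (undirected V E)"
proof -
  have "finite E"
    using assms(1,2) finite_subset by blast
  then show ?thesis
    using assms
    by unfold_locales (auto simp: undirected_def irrefl_def symmetric_def intro: symI)
qed

lemma pair_graph_H1: "pair_graph H1"
  unfolding H1_def by (rule pair_graph_undirected) (auto simp: cycle8_def irrefl_def)

lemma complete_bipartite_H2: "K\<^bsub>3,3\<^esub> (with_proj H2)"
proof -
  have "pverts H2 = {1..3} \<union> {4..6}" and "{1..3} \<inter> {4..6 :: nat} = {}"
    and "parcs H2 = {1..3} \<times> {4..6} \<union> {4..6} \<times> {1..3}"
    by (auto simp: H2_def undirected_def)
  moreover have "card {1..3 :: nat} = 3" and "card {4..6 :: nat} = 3" and "finite (pverts H2)"
    by (auto simp: H2_def undirected_def)
  ultimately show ?thesis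
    unfolding complete_bipartite_digraph_pair_def by blast
qed

lemma pair_graph_H3: "pair_graph H3"
  unfolding H3_def by (rule pair_graph_undirected) (auto simp: cycle8_def irrefl_def)

lemma pair_graph_H4: "pair_graph H4"
  unfolding H4_def
proof (rule pair_graph_undirected)
  have "(j + 1) mod 5 \<noteq> j \<and> (j + 2) mod 5 \<noteq> j" if "j < 5" for j :: nat
    using that by presburger
  then show "irrefl (\<Union>j<5. {(Inl j, Inl ((j + 1) mod 5)), (Inl j, Inr j),
      (Inr j, Inr ((j + 2) mod 5 :: nat))})"
    by (fastforce simp: irrefl_def)
qed auto

end

theory Submission
  imports Defs
begin

text \<open>
  Fix a maximal packing \<open>P\<close> and let \<open>W\<close> be the set of neighbours of \<open>P\<close>. A maximal independent
  subset \<open>I\<close> of \<open>W\<close> leaves undominated only those \<open>p \<in> P\<close> without a neighbour in \<open>I\<close> and some vertices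
  outside \<open>P \<union> W\<close>. Each of the latter is adjacent to a vertex of \<open>W - I\<close>, and no vertex of \<open>W - I\<close> has
  two of them as neighbours, because it already has a neighbour in \<open>P\<close> and one in \<open>I\<close>. Charging
  everything to \<open>P\<close>, a vertex \<open>p\<close> costs at most its degree, plus one if it is undominated; starting \<open>I\<close>
  from an independent transversal of the neighbourhoods whose vertices have few neighbours in \<open>W\<close> makes
  every cost at most 3. Hence \<open>i \<le> 3 \<rho>\<close>, and if equality holds then every cost is exactly 3. This makes
  the graph cubic and gives every \<open>x \<in> W\<close> that has a neighbour in \<open>W\<close> a neighbour outside \<open>P \<union> W\<close>
  whose only neighbour in \<open>W\<close> is \<open>x\<close>.

  Suppose that two vertices are at distance at least 3. The last property, applied to a path of length 3
  between vertices at distance 3, shows that all paths of length 3 with the same middle edge join vertices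
  at distance 3, and this spreads to the adjacent edges. By connectedness the girth is at least 6. The
  property then forces any two grandchildren of a vertex lying below different children to have a common
  neighbour, so the graph is the Heawood graph, which has an independent dominating set of size 5.
  Therefore the diameter is at most 2, and the cases of girth 3, 4 and 5 give \<open>H1\<close>, \<open>H2\<close> or \<open>H3\<close>,
  and \<open>H4\<close>.

  Conversely, in the four graphs two non-adjacent vertices share so many neighbours that they do not
  dominate the graph.
\<close>

section \<open>Independent dominating sets from maximal packings\<close>

text \<open>For symmetric \<open>E\<close> this means distance at least 3. Stating it by
  neighbourhoods keeps walks out of the combinatorial part; the link is
  \<open>three_le_distance_iff\<close>.\<close>

definition far :: "'a rel \<Rightarrow> 'a \<Rightarrow> 'a \<Rightarrow> bool" where
  "far E u v \<longleftrightarrow> u \<noteq> v \<and> (u, v) \<notin> E \<and> E `` {u} \<inter> E `` {v} = {}"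

text \<open>The degree bound ranges over all \<open>v\<close>: outside \<open>V\<close>
  neighbourhoods are empty, so no membership has to be carried along.\<close>

locale subcubic_graph =
  fixes V :: "'a set" and E :: "'a rel"
  assumes finite_V: "finite V"
    and E_subset: "E \<subseteq> V \<times> V"
    and sym_E: "sym E"
    and irrefl_E: "irrefl E"
    and degree_le: "card (E `` {v}) \<le> 3"
begin

abbreviation N :: "'a \<Rightarrow> 'a set" where "N v \<equiv> E `` {v}"

definition indep_dom :: "'a set \<Rightarrow> bool" where
  "indep_dom D \<longleftrightarrow> D \<subseteq> V \<and> E `` D \<inter> D = {} \<and> V \<subseteq> D \<union> E `` D"

definition pack :: "'a set \<Rightarrow> bool" where
  "pack P \<longleftrightarrow> P \<subseteq> V \<and> pairwise (far E) P"

text \<open>Maximality is by inclusion, not by size, so that any two far vertices can be put into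
  such a packing.\<close>

definition maximal_pack :: "'a set \<Rightarrow> bool" where
  "maximal_pack P \<longleftrightarrow> pack P \<and> (\<forall>v\<in>V - P. \<exists>p\<in>P. \<not> far E p v)"

lemma adj_sym: "(u, v) \<in> E \<Longrightarrow> (v, u) \<in> E"
  using sym_E by (rule symD)

lemma adj_irrefl [simp]: "(v, v) \<notin> E"
  using irrefl_E by (simp add: irrefl_def)

lemma adj_in_V: assumes "(u, v) \<in> E" shows "u \<in> V" "v \<in> V"
  using assms E_subset by auto

lemma finite_N [simp]: "finite (N v)"
  by (rule finite_subset[OF _ finite_V]) (use adj_in_V in auto)

lemma Image_subset: "E `` S \<subseteq> V"
  using adj_in_V by auto

lemma far_sym: "far E u v \<Longrightarrow> far E v u"
  by (auto simp: far_def dest: adj_sym)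

text \<open>The degree bound in its working form: once three distinct neighbours are known, every
  other adjacency of the vertex is decided.\<close>

lemma N_subset3:
  assumes "a \<in> N v" "b \<in> N v" "c \<in> N v" "a \<noteq> b" "a \<noteq> c" "b \<noteq> c"
  shows "N v = {a, b, c}"
proof -
  have "{a, b, c} = N v"
    by (rule card_seteq) (use assms degree_le[of v] in auto)
  then show ?thesis ..
qed

lemma extend_indep:
  assumes "S \<subseteq> W" "W \<subseteq> V" "E `` S \<inter> S = {}"
  obtains I where "S \<subseteq> I" "I \<subseteq> W" "E `` I \<inter> I = {}" "W \<subseteq> I \<union> E `` I"
proof -
  let ?A = "{I. I \<subseteq> W \<and> E `` I \<inter> I = {}}"
  have "finite ?A"
    by (rule finite_subset[of _ "Pow W"]) (use assms finite_V finite_subset in auto)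
  then obtain I where I: "I \<in> ?A" "S \<subseteq> I" "\<forall>J\<in>?A. I \<subseteq> J \<longrightarrow> I = J"
    using finite_has_maximal2[of ?A S] assms by auto
  have "w \<in> I \<union> E `` I" if "w \<in> W" for w
  proof (rule ccontr)
    assume w: "w \<notin> I \<union> E `` I"
    then have "insert w I \<in> ?A"
      using I(1) that adj_sym by auto
    from bspec[OF I(3) this] have "I = insert w I"
      by (simp add: subset_insertI)
    then show False
      using w by blast
  qed
  then have "W \<subseteq> I \<union> E `` I"
    by (rule subsetI)
  with I that[of I] show ?thesis
    by simp
qed

lemma extend_pack:
  assumes "pack S"
  obtains P where "S \<subseteq> P" "maximal_pack P"
proof -
  let ?A = "{P. pack P}"
  have "finite ?A"
    by (rule finite_subset[of _ "Pow V"]) (use finite_V in \<open>auto simp: pack_def\<close>)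
  then obtain P where P: "P \<in> ?A" "S \<subseteq> P" "\<forall>J\<in>?A. P \<subseteq> J \<longrightarrow> P = J"
    using finite_has_maximal2[of ?A S] assms by auto
  have "\<exists>p\<in>P. \<not> far E p v" if "v \<in> V - P" for v
  proof (rule ccontr)
    assume "\<not> (\<exists>p\<in>P. \<not> far E p v)"
    then have "\<forall>p\<in>P. far E p v \<and> far E v p"
      using far_sym by blast
    then have "insert v P \<in> ?A"
      using P(1) that by (simp add: pack_def pairwise_insert)
    from bspec[OF P(3) this] have "P = insert v P"
      by (simp add: subset_insertI)
    then show False
      using that by blast
  qed
  then show ?thesis
    using P that[of P] by (simp add: maximal_pack_def)
qed

lemma pack_finite: "pack P \<Longrightarrow> finite P"
  using finite_V finite_subset by (auto simp: pack_def)

lemma pack_far: "pack P \<Longrightarrow> p \<in> P \<Longrightarrow> q \<in> P \<Longrightarrow> p \<noteq> q \<Longrightarrow> far E p q"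
  by (auto simp: pack_def pairwise_def)

lemma packD:
  assumes P: "pack P" "p \<in> P"
  shows "p \<notin> E `` P" "q \<in> P \<Longrightarrow> z \<in> N p \<Longrightarrow> z \<in> N q \<Longrightarrow> p = q"
proof -
  have "(q, p) \<notin> E" if "q \<in> P" for q
    using pack_far[OF P(1) that P(2)] by (cases "p = q") (auto simp: far_def)
  then show "p \<notin> E `` P"
    by auto
  show "p = q" if "q \<in> P" "z \<in> N p" "z \<in> N q"
    using pack_far[OF P that(1)] that by (auto simp: far_def)
qed

text \<open>Neighbourhoods of distinct packing vertices are disjoint, so they partition the set W of
  neighbours of \<open>P\<close>, and charges can be counted one packing vertex at a time.\<close>

lemma card_Image_pack:
  assumes "pack P" "A \<subseteq> E `` P"
  shows "card A = (\<Sum>p\<in>P. card (N p \<inter> A))"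
proof -
  have "A = (\<Union>p\<in>P. N p \<inter> A)"
    using assms(2) by auto
  then have "card A = card (\<Union>p\<in>P. N p \<inter> A)"
    by simp
  also have "\<dots> = (\<Sum>p\<in>P. card (N p \<inter> A))"
    by (rule card_UN_disjoint) (use pack_finite[OF assms(1)] packD(2)[OF assms(1)] in \<open>simp, simp, blast\<close>)
  finally show ?thesis .
qed

text \<open>\<open>D\<close> consists of \<open>I\<close>, the packing vertices that
  \<open>I\<close> misses, and an independent set outside \<open>P\<close> and W. The last set is
  counted through an injection into W - \<open>I\<close>, whose image is \<open>X\<close>. The
  vertex \<open>x\<close> is a parameter: the injection avoids it wherever it can.\<close>

lemma indep_dom_of_pack:
  assumes P: "maximal_pack P" and T: "T \<subseteq> E `` P" "E `` T \<inter> T = {}"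
  obtains D I X where "indep_dom D" "T \<subseteq> I" "I \<subseteq> E `` P" "E `` I \<inter> I = {}"
    "X \<subseteq> E `` P - I" "card D \<le> card I + card X + card (P - E `` I)"
    "\<forall>z\<in>X. card (N z \<inter> E `` P) \<le> 1"
    "x \<in> X \<longrightarrow> (\<exists>y\<in>N x. y \<notin> P \<and> y \<notin> E `` P \<and> N y \<inter> E `` P = {x})"
proof -
  let ?W = "E `` P"
  have pk: "pack P" and PV: "P \<subseteq> V"
    using P by (auto simp: maximal_pack_def pack_def)
  obtain I where I: "T \<subseteq> I" "I \<subseteq> ?W" "E `` I \<inter> I = {}" "?W \<subseteq> I \<union> E `` I"
    using extend_indep[OF T(1) Image_subset T(2)] .
  \<comment> \<open>The part outside \<open>P\<close> that \<open>I\<close> leaves undominated. As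
    \<open>I\<close> dominates W, no vertex of W remains in it.\<close>
  let ?R = "V - P - I - E `` I"
  obtain Y where Y: "Y \<subseteq> ?R" "E `` Y \<inter> Y = {}" "?R \<subseteq> Y \<union> E `` Y"
    using extend_indep[of "{}" ?R] by auto
  define B where "B = P - E `` I"
  define D where "D = I \<union> B \<union> Y"
  have YW: "Y \<inter> ?W = {}"
    using Y(1) I(4) by auto
  have IV: "I \<subseteq> V"
    using I(2) Image_subset by blast
  have "D \<subseteq> V"
    using IV Y(1) PV by (auto simp: D_def B_def)
  moreover have "E `` D \<inter> D = {}"
  proof -
    have "(a, b) \<notin> E" if "a \<in> D" "b \<in> D" for a b
      using that I(3) Y(1,2) YW packD(1)[OF pk] adj_sym[of a b]
      unfolding D_def B_def by blast
    then show ?thesis by blast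
  qed
  moreover have "V \<subseteq> D \<union> E `` D"
    using Y(3) unfolding D_def B_def by blast
  ultimately have D: "indep_dom D"
    by (simp add: indep_dom_def)
  define C where "C y = N y \<inter> ?W" for y
  \<comment> \<open>\<open>y\<close> is charged to \<open>g y\<close>, and to \<open>x\<close> only if there is no other choice.\<close>
  define g where "g y = (SOME z. z \<in> C y \<and> (C y \<noteq> {x} \<longrightarrow> z \<noteq> x))" for y
  have g: "g y \<in> C y \<and> (C y \<noteq> {x} \<longrightarrow> g y \<noteq> x)" if y: "y \<in> Y" for y
  proof -
    \<comment> \<open>Maximality of \<open>P\<close> gives \<open>y\<close> a vertex of
      \<open>P\<close> at distance exactly 2, and the middle vertex lies in W.\<close>
    from y Y(1) have "y \<in> V - P" by auto
    then obtain p where p: "p \<in> P" "\<not> far E p y"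
      using P by (auto simp: maximal_pack_def)
    then obtain z where "z \<in> N p \<inter> N y"
      using y YW \<open>y \<in> V - P\<close> by (auto simp: far_def)
    then have "C y \<noteq> {}"
      using p by (auto simp: C_def)
    then have "\<exists>z. z \<in> C y \<and> (C y \<noteq> {x} \<longrightarrow> z \<noteq> x)"
      by blast
    then show ?thesis
      unfolding g_def by (rule someI_ex)
  qed
  have gI: "g y \<in> ?W - I" "(g y, y) \<in> E" if "y \<in> Y" for y
    using g[OF that] that Y(1) adj_sym by (auto simp: C_def)
  \<comment> \<open>A neighbour in \<open>P\<close>, one in \<open>I\<close> and \<open>y\<close>
    itself use up the degree of \<open>g y\<close>. This makes \<open>g\<close> injective and leaves
    \<open>g y\<close> at most one neighbour in W.\<close>
  have nbrs: "\<exists>p\<in>P. \<exists>i\<in>I. N (g y) = {p, i, y} \<and> p \<noteq> i \<and> p \<noteq> y \<and> i \<noteq> y" if y: "y \<in> Y" for y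
  proof -
    obtain p i where "p \<in> P" "i \<in> I" "(p, g y) \<in> E" "(i, g y) \<in> E"
      using gI[OF y] I(4) by blast
    moreover have "p \<noteq> i" "p \<noteq> y" "i \<noteq> y"
      using calculation packD(1)[OF pk] I(2) y Y(1) by blast+
    moreover have "N (g y) = {p, i, y}"
      by (rule N_subset3) (use calculation gI[OF y] adj_sym in auto)
    ultimately show ?thesis by blast
  qed
  have inj: "inj_on g Y"
  proof (rule inj_onI)
    fix y y' assume *: "y \<in> Y" "y' \<in> Y" "g y = g y'"
    then have "y' \<in> N (g y)"
      using gI(2)[of y'] by auto
    moreover obtain p i where "p \<in> P" "i \<in> I" "N (g y) = {p, i, y}"
      using nbrs[OF *(1)] by blast
    moreover have "y' \<notin> P" "y' \<notin> I"
      using *(2) Y(1) by auto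
    ultimately show "y = y'"
      by auto
  qed
  show ?thesis
  proof (rule that[of D I "g ` Y"])
    show "indep_dom D" "T \<subseteq> I" "I \<subseteq> ?W" "E `` I \<inter> I = {}" by fact+
    show "g ` Y \<subseteq> ?W - I"
      using gI(1) by blast
    have "card (I \<union> B \<union> Y) \<le> card I + card B + card Y"
      using card_Un_le[of "I \<union> B" Y] card_Un_le[of I B] by linarith
    then show "card D \<le> card I + card (g ` Y) + card (P - E `` I)"
      by (simp add: D_def B_def card_image[OF inj])
    show "\<forall>z\<in>g ` Y. card (N z \<inter> ?W) \<le> 1"
    proof
      fix z assume "z \<in> g ` Y"
      then obtain y p i where "z = g y" "y \<in> Y" "p \<in> P" "N z = {p, i, y}"
        using nbrs by blast
      then have "N z \<inter> ?W \<subseteq> {i}"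
        using YW packD(1)[OF pk] by auto
      then show "card (N z \<inter> ?W) \<le> 1"
        using card_mono[of "{i}"] by auto
    qed
    show "x \<in> g ` Y \<longrightarrow> (\<exists>y\<in>N x. y \<notin> P \<and> y \<notin> ?W \<and> N y \<inter> ?W = {x})"
    proof
      assume "x \<in> g ` Y"
      then obtain y where y: "y \<in> Y" "x = g y"
        by auto
      then have "N y \<inter> ?W = {x}"
        using g[OF y(1)] by (auto simp: C_def)
      then show "\<exists>y\<in>N x. y \<notin> P \<and> y \<notin> ?W \<and> N y \<inter> ?W = {x}"
        using y gI(2) YW Y(1) by blast
    qed
  qed
qed

section \<open>Independent transversals of the neighbourhoods\<close>

text \<open>
  The set \<open>A r\<close> may be a singleton: choosing a vertex in one part deletes at most one vertex of
  the other parts, so that allowing a single small part makes the induction go through.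
\<close>

lemma independent_transversal:
  assumes "finite Q"
    and "\<And>p q. p \<in> Q \<Longrightarrow> q \<in> Q \<Longrightarrow> p \<noteq> q \<Longrightarrow> A p \<inter> A q = {}"
    and "\<And>p. p \<in> Q \<Longrightarrow> A p \<subseteq> W"
    and "\<And>p u. p \<in> Q \<Longrightarrow> u \<in> A p \<Longrightarrow> card (N u \<inter> W) \<le> 1"
    and "\<And>p. p \<in> Q \<Longrightarrow> A p \<noteq> {}"
    and "\<And>p. p \<in> Q \<Longrightarrow> p \<noteq> r \<Longrightarrow> 2 \<le> card (A p)"
  shows "\<exists>T \<subseteq> \<Union>(A ` Q). E `` T \<inter> T = {} \<and> (\<forall>p\<in>Q. T \<inter> A p \<noteq> {})"
  using assms
proof (induction "card Q" arbitrary: Q A r)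
  case 0
  then show ?case by auto
next
  case (Suc n)
  then have "Q \<noteq> {}" by auto
  \<comment> \<open>The part allowed to be small is served first, so that every part left has at
    least two vertices.\<close>
  then obtain p where p: "p \<in> Q" "r \<in> Q \<longrightarrow> p = r" by auto
  then obtain c where c: "c \<in> A p" using Suc.prems(5) by blast
  let ?Q = "Q - {p}" and ?A = "\<lambda>s. A s - N c"
  have big: "2 \<le> card (A s)" if "s \<in> ?Q" for s
    using that p Suc.prems(6)[of s] by auto
  have le1: "card (N c \<inter> W) \<le> 1"
    using Suc.prems(4)[OF p(1) c] .
  have uniq: "a = b" if "a \<in> N c \<inter> W" "b \<in> N c \<inter> W" for a b
    using le1 that card_le_Suc0_iff_eq[of "N c \<inter> W"] by auto
  \<comment> \<open>The part that loses a vertex to \<open>c\<close>, arbitrary if there is none. By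
    \<open>only\<close> there is at most one, and it takes the place of \<open>r\<close> in the
    induction.\<close>
  define r' where "r' = (SOME s. s \<in> ?Q \<and> A s \<inter> N c \<noteq> {})"
  have only: "s = r'" if s: "s \<in> ?Q" "A s \<inter> N c \<noteq> {}" for s
  proof -
    have r': "r' \<in> ?Q \<and> A r' \<inter> N c \<noteq> {}"
      unfolding r'_def by (rule someI[of _ s]) (use s in auto)
    then obtain a b where "a \<in> A s" "a \<in> N c" "b \<in> A r'" "b \<in> N c"
      using s(2) by auto
    moreover have "A s \<subseteq> W" "A r' \<subseteq> W"
      using Suc.prems(3) s(1) r' by auto
    ultimately have "a = b"
      using uniq by blast
    with \<open>a \<in> A s\<close> \<open>b \<in> A r'\<close> show ?thesis
      using Suc.prems(2)[of s r'] s(1) r' by auto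
  qed
  have "\<exists>T \<subseteq> \<Union>(?A ` ?Q). E `` T \<inter> T = {} \<and> (\<forall>p\<in>?Q. T \<inter> ?A p \<noteq> {})"
  proof (rule Suc.hyps(1)[where r = r'])
    show "n = card ?Q"
      using Suc.hyps(2) p(1) Suc.prems(1) by simp
    show "finite ?Q"
      using Suc.prems(1) by simp
    show "?A s \<inter> ?A t = {}" if "s \<in> ?Q" "t \<in> ?Q" "s \<noteq> t" for s t
      using Suc.prems(2)[of s t] that by auto
    show "?A s \<subseteq> W" if "s \<in> ?Q" for s
      using Suc.prems(3)[of s] that by auto
    show "card (N u \<inter> W) \<le> 1" if "s \<in> ?Q" "u \<in> ?A s" for s u
      using Suc.prems(4)[of s u] that by auto
    show "?A s \<noteq> {}" if "s \<in> ?Q" for s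
    proof
      assume "?A s = {}"
      then have "A s \<subseteq> N c \<inter> W"
        using Suc.prems(3)[of s] that by auto
      then have "card (A s) \<le> 1"
        using le1 card_mono[of "N c \<inter> W" "A s"] by simp
      then show False
        using big[OF that] by simp
    qed
    show "2 \<le> card (?A s)" if "s \<in> ?Q" "s \<noteq> r'" for s
    proof -
      have "?A s = A s"
        using only[OF that(1)] that(2) by auto
      then show ?thesis
        using big[OF that(1)] by simp
    qed
  qed
  then obtain T where T: "T \<subseteq> \<Union>(?A ` ?Q)" "E `` T \<inter> T = {}" "\<forall>p\<in>?Q. T \<inter> ?A p \<noteq> {}"
    by blast
  have "T \<inter> N c = {}"
    using T(1) by auto
  then have "E `` insert c T \<inter> insert c T = {}"
    using T(2) adj_sym[of _ c] by auto
  moreover have "insert c T \<subseteq> \<Union>(A ` Q)"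
    using T(1) c p(1) by auto
  moreover have "\<forall>p\<in>Q. insert c T \<inter> A p \<noteq> {}"
    using T(3) c by blast
  ultimately show ?case by blast
qed

text \<open>After \<open>x\<close>, the packing vertices that still need hitting get a transversal
  of their neighbourhoods outside \<open>N x\<close>. The third alternative is harmless for the
  count, since a vertex with two neighbours in W never receives a charge. Keeping \<open>z\<close>
  outside \<open>N x\<close> later distinguishes it from a given neighbour of
  \<open>x\<close>.\<close>

lemma indep_hitting_set:
  assumes P: "pack P" and x: "x \<in> E `` P"
  obtains T where "T \<subseteq> E `` P" "E `` T \<inter> T = {}" "x \<in> T"
    "\<forall>p\<in>P. card (N p) \<le> 2 \<or> N p \<inter> T \<noteq> {} \<or> (\<exists>z\<in>N p - N x. 2 \<le> card (N z \<inter> E `` P))"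
proof -
  let ?W = "E `` P"
  define Q where "Q = {p \<in> P. x \<notin> N p \<and> card (N p) = 3 \<and> (\<forall>z\<in>N p - N x. card (N z \<inter> ?W) \<le> 1)}"
  define A where "A p = N p - N x" for p
  obtain p0 where p0: "p0 \<in> P" "(p0, x) \<in> E"
    using x by auto
  have two: "card (N x \<inter> ?W) \<le> 2"
  proof -
    have "N x \<inter> ?W \<subseteq> N x - {p0}"
      using packD(1)[OF P p0(1)] by auto
    then have "card (N x \<inter> ?W) \<le> card (N x - {p0})"
      by (intro card_mono) auto
    also have "\<dots> = card (N x) - 1"
      using p0(2) adj_sym by simp
    finally show ?thesis
      using degree_le[of x] by simp
  qed
  have cardA: "card (A p) = 3 - card (N p \<inter> N x)" if "p \<in> Q" for p
    using that by (simp add: A_def card_Diff_subset_Int Q_def)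
  have sub: "N p \<inter> N x \<subseteq> N x \<inter> ?W" if "p \<in> Q" for p
    using that by (auto simp: Q_def)
  \<comment> \<open>At most two neighbours of \<open>x\<close> lie in W, so at most one part loses
    two vertices. It keeps a third and is the small part allowed in
    \<open>independent_transversal\<close>.\<close>
  define r where "r = (SOME p. p \<in> Q \<and> 2 \<le> card (N p \<inter> N x))"
  have disj: "N p \<inter> N q = {}" if "p \<in> Q" "q \<in> Q" "p \<noteq> q" for p q
    using packD(2)[OF P, of p q] that by (auto simp: Q_def)
  have "\<exists>T \<subseteq> \<Union>(A ` Q). E `` T \<inter> T = {} \<and> (\<forall>p\<in>Q. T \<inter> A p \<noteq> {})"
  proof (rule independent_transversal[where r = r and W = ?W])
    show "finite Q"
      using pack_finite[OF P] by (simp add: Q_def)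
    show "A p \<inter> A q = {}" if "p \<in> Q" "q \<in> Q" "p \<noteq> q" for p q
      using disj[OF that] by (auto simp: A_def)
    show "A p \<subseteq> ?W" if "p \<in> Q" for p
      using that by (auto simp: A_def Q_def)
    show "card (N u \<inter> ?W) \<le> 1" if "p \<in> Q" "u \<in> A p" for p u
      using that by (simp add: A_def Q_def)
    show "A p \<noteq> {}" if "p \<in> Q" for p
    proof -
      have "card (N p \<inter> N x) \<le> 2"
        using two card_mono[OF _ sub[OF that]] by simp
      then show ?thesis
        using cardA[OF that] by auto
    qed
    show "2 \<le> card (A p)" if p: "p \<in> Q" "p \<noteq> r" for p
    proof (rule ccontr)
      assume "\<not> 2 \<le> card (A p)"
      then have large: "2 \<le> card (N p \<inter> N x)"
        using cardA[OF p(1)] by simp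
      have r: "r \<in> Q \<and> 2 \<le> card (N r \<inter> N x)"
        unfolding r_def
        by (rule someI[of "\<lambda>p. p \<in> Q \<and> 2 \<le> card (N p \<inter> N x)", OF conjI[OF p(1) large]])
      have "card ((N p \<inter> N x) \<union> (N r \<inter> N x)) = card (N p \<inter> N x) + card (N r \<inter> N x)"
        by (rule card_Un_disjoint) (use disj[of p r] p r in auto)
      moreover have "card ((N p \<inter> N x) \<union> (N r \<inter> N x)) \<le> card (N x \<inter> ?W)"
        by (rule card_mono) (use sub[of p] sub[of r] p r in auto)
      ultimately show False
        using two large r by simp
    qed
  qed
  then obtain T where T: "T \<subseteq> \<Union>(A ` Q)" "E `` T \<inter> T = {}" "\<forall>p\<in>Q. T \<inter> A p \<noteq> {}"
    by blast
  have "T \<inter> N x = {}"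
    using T(1) by (auto simp: A_def)
  show ?thesis
  proof (rule that[of "insert x T"])
    show "insert x T \<subseteq> ?W"
      using T(1) x by (auto simp: A_def Q_def)
    show "E `` insert x T \<inter> insert x T = {}"
      using T(2) \<open>T \<inter> N x = {}\<close> adj_sym[of _ x] by auto
    show "x \<in> insert x T" by simp
    show "\<forall>p\<in>P. card (N p) \<le> 2 \<or> N p \<inter> insert x T \<noteq> {} \<or> (\<exists>z\<in>N p - N x. 2 \<le> card (N z \<inter> ?W))"
    proof
      fix p assume p: "p \<in> P"
      show "card (N p) \<le> 2 \<or> N p \<inter> insert x T \<noteq> {} \<or> (\<exists>z\<in>N p - N x. 2 \<le> card (N z \<inter> ?W))"
      proof (cases "p \<in> Q")
        case True
        then show ?thesis
          using T(3) by (auto simp: A_def)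
      next
        case False
        then show ?thesis
          using p degree_le[of p] by (force simp: Q_def)
      qed
    qed
  qed
qed

end

text \<open>The equality enters only through two inequalities, with \<open>r\<close> the packing
  number. Connectedness says that no proper nonempty set of vertices is closed under adjacency, the
  form in which local structure spreads to the whole graph.\<close>

locale tight_graph = subcubic_graph +
  fixes r :: nat
  assumes V_nonempty: "V \<noteq> {}"
    and connected: "\<And>S. S \<subseteq> V \<Longrightarrow> S \<noteq> {} \<Longrightarrow> E `` S \<subseteq> S \<Longrightarrow> S = V"
    and card_indep_dom_ge: "\<And>D. indep_dom D \<Longrightarrow> 3 * r \<le> card D"
    and card_pack_le: "\<And>P. pack P \<Longrightarrow> card P \<le> r"
begin

text \<open>The costs sum to at least \<open>card D\<close>, hence to at least three times
  \<open>card P\<close>, while no single cost exceeds 3. So each cost equals 3.\<close>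

lemma tight_costs:
  assumes P: "maximal_pack P" and T: "T \<subseteq> E `` P" "E `` T \<inter> T = {}"
    and hit: "\<forall>p\<in>P. card (N p) \<le> 2 \<or> N p \<inter> T \<noteq> {} \<or> (\<exists>z\<in>N p. 2 \<le> card (N z \<inter> E `` P))"
  obtains I X where "T \<subseteq> I" "E `` I \<inter> I = {}" "X \<inter> I = {}"
    "\<forall>p\<in>P. card (N p \<inter> I) + card (N p \<inter> X) + (if N p \<inter> I = {} then 1 else 0) = 3"
    "\<forall>z\<in>X. card (N z \<inter> E `` P) \<le> 1"
    "x \<in> X \<longrightarrow> (\<exists>y\<in>N x. y \<notin> P \<and> y \<notin> E `` P \<and> N y \<inter> E `` P = {x})"
proof -
  obtain D I X where D: "indep_dom D" "T \<subseteq> I" "I \<subseteq> E `` P" "E `` I \<inter> I = {}"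
    "X \<subseteq> E `` P - I" "card D \<le> card I + card X + card (P - E `` I)"
    "\<forall>z\<in>X. card (N z \<inter> E `` P) \<le> 1"
    "x \<in> X \<longrightarrow> (\<exists>y\<in>N x. y \<notin> P \<and> y \<notin> E `` P \<and> N y \<inter> E `` P = {x})"
    using indep_dom_of_pack[OF P T, of x] .
  have pk: "pack P"
    using P by (simp add: maximal_pack_def)
  let ?cost = "\<lambda>p. card (N p \<inter> I) + card (N p \<inter> X) + (if N p \<inter> I = {} then 1 else 0 :: nat)"
  have "P - E `` I = {p \<in> P. N p \<inter> I = {}}"
    using adj_sym by blast
  then have "card (P - E `` I) = (\<Sum>p\<in>P. if N p \<inter> I = {} then 1 else 0)"
    using pack_finite[OF pk] by (simp add: sum.inter_filter[symmetric])
  moreover have "X \<subseteq> E `` P"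
    using D(5) by auto
  ultimately have "card I + card X + card (P - E `` I) = (\<Sum>p\<in>P. ?cost p)"
    using card_Image_pack[OF pk, of I] card_Image_pack[OF pk, of X] D(3)
    by (simp add: sum.distrib)
  \<comment> \<open>Here \<open>card P\<close> may be below \<open>r\<close>; the inequality goes in
    the right direction.\<close>
  then have ge: "3 * card P \<le> (\<Sum>p\<in>P. ?cost p)"
    using D(6) card_indep_dom_ge[OF D(1)] card_pack_le[OF pk] by linarith
  have le: "?cost p \<le> 3" if p: "p \<in> P" for p
  proof -
    have "card (N p \<inter> I) + card (N p \<inter> X) = card (N p \<inter> I \<union> N p \<inter> X)"
      by (rule card_Un_disjoint[symmetric]) (use D(5) in auto)
    also have "\<dots> \<le> card (N p)"
      by (rule card_mono) auto
    finally have sum: "card (N p \<inter> I) + card (N p \<inter> X) \<le> card (N p)" .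
    show ?thesis
    proof (cases "N p \<inter> I = {}")
      case False
      then show ?thesis
        using sum degree_le[of p] by simp
    next
      case True
      \<comment> \<open>For an undominated \<open>p\<close> of degree 3, \<open>hit\<close> supplies
        a neighbour with two neighbours in W. It is not in \<open>X\<close>, which leaves room for
        the extra 1.\<close>
      have "card (N p \<inter> X) \<le> 2"
      proof (cases "card (N p) \<le> 2")
        case False
        moreover have "N p \<inter> T = {}"
          using True D(2) by blast
        ultimately obtain z where z: "z \<in> N p" "2 \<le> card (N z \<inter> E `` P)"
          using hit p by blast
        then have "z \<notin> X"
          using D(7) by auto
        then have "card (N p \<inter> X) \<le> card (N p - {z})"
          by (intro card_mono) auto
        then show ?thesis
          using z(1) degree_le[of p] by simp
      qed (use sum in simp)
      then show ?thesis
        using True by simp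
    qed
  qed
  have eq: "?cost p = 3" if p: "p \<in> P" for p
  proof (rule ccontr)
    assume "?cost p \<noteq> 3"
    then have "?cost p < 3"
      using le[OF p] by linarith
    then have "(\<Sum>p\<in>P. ?cost p) < (\<Sum>p\<in>P. 3)"
      by (intro sum_strict_mono_ex1 pack_finite[OF pk] ballI le bexI[OF _ p])
    then show False
      using ge by simp
  qed
  show ?thesis
  proof (rule that[of I X])
    show "X \<inter> I = {}"
      using D(5) by auto
    show "\<forall>p\<in>P. ?cost p = 3"
      using eq by (rule ballI)
  qed (fact D)+
qed

lemma pack_singleton: "v \<in> V \<Longrightarrow> pack {v}"
  by (simp add: pack_def)

text \<open>\<open>T\<close> is started at a neighbour of \<open>v\<close>, so \<open>v\<close> is
  dominated and its cost 3 is paid entirely by its neighbours.\<close>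

lemma cubic:
  assumes "v \<in> V"
  shows "card (N v) = 3"
proof -
  obtain P where P: "{v} \<subseteq> P" "maximal_pack P"
    using extend_pack[OF pack_singleton[OF assms]] .
  have pk: "pack P"
    using P(2) by (simp add: maximal_pack_def)
  obtain T where T: "T \<subseteq> E `` P" "E `` T \<inter> T = {}" "N v = {} \<or> N v \<inter> T \<noteq> {}"
    "\<forall>p\<in>P. card (N p) \<le> 2 \<or> N p \<inter> T \<noteq> {} \<or> (\<exists>z\<in>N p. 2 \<le> card (N z \<inter> E `` P))"
  \<comment> \<open>If \<open>P\<close> has no neighbours, there is no vertex to start from, and the
    empty set serves.\<close>
  proof (cases "E `` P = {}")
    case True
    then have "N p = {}" if "p \<in> P" for p
      using that by auto
    then show ?thesis
      using P(1) that[of "{}"] by auto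
  next
    case False
    then obtain x where x: "x \<in> E `` P" "N v = {} \<or> x \<in> N v"
      using P(1) by auto
    obtain T where T: "T \<subseteq> E `` P" "E `` T \<inter> T = {}" "x \<in> T"
      "\<forall>p\<in>P. card (N p) \<le> 2 \<or> N p \<inter> T \<noteq> {} \<or> (\<exists>z\<in>N p - N x. 2 \<le> card (N z \<inter> E `` P))"
      using indep_hitting_set[OF pk x(1)] .
    show ?thesis
    proof (rule that[OF T(1,2)])
      show "N v = {} \<or> N v \<inter> T \<noteq> {}"
        using x(2) T(3) by auto
      show "\<forall>p\<in>P. card (N p) \<le> 2 \<or> N p \<inter> T \<noteq> {} \<or> (\<exists>z\<in>N p. 2 \<le> card (N z \<inter> E `` P))"
        using T(4) by (meson DiffD1)
    qed
  qed
  obtain I X where I: "T \<subseteq> I" "X \<inter> I = {}"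
    "\<forall>p\<in>P. card (N p \<inter> I) + card (N p \<inter> X) + (if N p \<inter> I = {} then 1 else 0) = 3"
    using tight_costs[OF P(2) T(1,2,4)] .
  have cost: "card (N v \<inter> I) + card (N v \<inter> X) + (if N v \<inter> I = {} then 1 else 0) = 3"
    using I(3) P(1) by simp
  \<comment> \<open>An isolated \<open>v\<close> would only pay the 1 for being undominated.\<close>
  then have "N v \<noteq> {}" by auto
  then have "N v \<inter> I \<noteq> {}"
    using T(3) I(1) by auto
  then have "3 = card (N v \<inter> I) + card (N v \<inter> X)"
    using cost by simp
  also have "\<dots> = card (N v \<inter> I \<union> N v \<inter> X)"
    by (rule card_Un_disjoint[symmetric]) (use I(2) in auto)
  also have "\<dots> \<le> card (N v)"
    by (rule card_mono) auto
  finally show ?thesis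
    using degree_le[of v] by simp
qed

text \<open>Starting \<open>T\<close> at \<open>x'\<close> keeps \<open>x\<close> out of
  \<open>I\<close>. The cost 3 of the packing neighbour \<open>p\<close> of \<open>x\<close> then
  forces \<open>x\<close> into \<open>X\<close>: otherwise at most two neighbours of
  \<open>p\<close> pay, and at most one if \<open>p\<close> is undominated.\<close>

lemma matched_private_neighbour:
  assumes P: "maximal_pack P" and x: "x \<in> E `` P" "x' \<in> E `` P" "(x, x') \<in> E"
  obtains y where "(x, y) \<in> E" "y \<notin> P" "y \<notin> E `` P" "N y \<inter> E `` P = {x}"
proof -
  have pk: "pack P"
    using P by (simp add: maximal_pack_def)
  obtain T where T: "T \<subseteq> E `` P" "E `` T \<inter> T = {}" "x' \<in> T"
    "\<forall>p\<in>P. card (N p) \<le> 2 \<or> N p \<inter> T \<noteq> {} \<or> (\<exists>z\<in>N p - N x'. 2 \<le> card (N z \<inter> E `` P))"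
    using indep_hitting_set[OF pk x(2)] .
  have hit: "\<forall>p\<in>P. card (N p) \<le> 2 \<or> N p \<inter> T \<noteq> {} \<or> (\<exists>z\<in>N p. 2 \<le> card (N z \<inter> E `` P))"
    using T(4) by blast
  obtain I X where I: "T \<subseteq> I" "E `` I \<inter> I = {}" "X \<inter> I = {}"
    "\<forall>p\<in>P. card (N p \<inter> I) + card (N p \<inter> X) + (if N p \<inter> I = {} then 1 else 0) = 3"
    "\<forall>z\<in>X. card (N z \<inter> E `` P) \<le> 1"
    "x \<in> X \<longrightarrow> (\<exists>y\<in>N x. y \<notin> P \<and> y \<notin> E `` P \<and> N y \<inter> E `` P = {x})"
    using tight_costs[OF P T(1,2) hit, where x = x] .
  obtain p where p: "p \<in> P" "(p, x) \<in> E"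
    using x(1) by auto
  have c3: "card (N p) = 3"
    using cubic[of p] p(2) adj_in_V by auto
  have "x \<in> X"
  proof (rule ccontr)
    assume "x \<notin> X"
    have "x \<notin> I"
      using I(1,2) T(3) adj_sym[OF x(3)] by blast
    have cost: "card (N p \<inter> I) + card (N p \<inter> X) + (if N p \<inter> I = {} then 1 else 0) = 3"
      using I(4) p(1) by blast
    show False
    proof (cases "N p \<inter> I = {}")
      case False
      have "card (N p \<inter> I) + card (N p \<inter> X) = card (N p \<inter> I \<union> N p \<inter> X)"
        by (rule card_Un_disjoint[symmetric]) (use I(3) in auto)
      also have "\<dots> \<le> card (N p - {x})"
        by (rule card_mono) (use \<open>x \<notin> X\<close> \<open>x \<notin> I\<close> in auto)
      also have "\<dots> = 2"
        using p(2) c3 by simp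
      finally show False
        using cost False by simp
    next
      case True
      then have "N p \<inter> T = {}"
        using I(1) by auto
      \<comment> \<open>As \<open>x\<close> is in \<open>N x'\<close> and \<open>z\<close> is not,
        these are two different neighbours of \<open>p\<close> that pay nothing.\<close>
      then obtain z where z: "z \<in> N p" "z \<notin> N x'" "2 \<le> card (N z \<inter> E `` P)"
        using bspec[OF T(4) p(1)] c3 by auto
      then have "z \<notin> X" "z \<noteq> x"
        using I(5) adj_sym[OF x(3)] by auto
      then have "card (N p \<inter> X) \<le> card (N p - {x, z})"
        using \<open>x \<notin> X\<close> by (intro card_mono) auto
      also have "\<dots> = 1"
        using z(1) p(2) c3 \<open>z \<noteq> x\<close> by (simp add: card_Diff_subset)
      finally show False
        using cost True by simp
    qed
  qed
  then show ?thesis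
    using I(6) that by auto
qed

subsection \<open>Vertices at distance three\<close>

lemma nbrs_other2:
  assumes "(v, a) \<in> E"
  obtains b c where "N v = {a, b, c}" "a \<noteq> b" "a \<noteq> c" "b \<noteq> c"
proof -
  have "card (N v - {a}) = 2"
    using assms cubic[of v] adj_in_V by auto
  then obtain b c where bc: "N v - {a} = {b, c}" "b \<noteq> c"
    by (auto simp: card_2_iff)
  then have "N v = {a, b, c}" "a \<noteq> b" "a \<noteq> c"
    using assms by auto
  then show ?thesis
    using bc(2) that by blast
qed

lemma nbrs_other1:
  assumes "(v, a) \<in> E" "(v, b) \<in> E" "a \<noteq> b"
  obtains c where "N v = {a, b, c}" "c \<noteq> a" "c \<noteq> b"
proof -
  obtain b' c' where "N v = {a, b', c'}" "a \<noteq> b'" "a \<noteq> c'" "b' \<noteq> c'"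
    using nbrs_other2[OF assms(1)] .
  moreover from this have "b = b' \<or> b = c'"
    using assms(2,3) by auto
  ultimately show ?thesis
    using that[of b'] that[of c'] by (auto simp: insert_commute)
qed

text \<open>In a maximal packing through \<open>p\<close> and \<open>q\<close>, the vertices
  \<open>x\<close> and \<open>x'\<close> are adjacent members of W, and \<open>y\<close> is the
  private neighbour of \<open>x\<close>. A common neighbour of \<open>y\<close> and \<open>q\<close>
  would lie in W and thus be \<open>x\<close>, which is not adjacent to \<open>q\<close>.\<close>

lemma far_private:
  assumes pq: "far E p q" and e: "(x, p) \<in> E" "(x, x') \<in> E" "(x', q) \<in> E"
  obtains y where "N x = {p, x', y}" "y \<noteq> p" "y \<noteq> x'" "far E y q" "(p, y) \<notin> E"
proof -
  have "pack {p, q}"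
    using pq far_sym[OF pq] adj_in_V e by (auto simp: pack_def pairwise_def)
  then obtain P where P: "{p, q} \<subseteq> P" "maximal_pack P"
    by (rule extend_pack)
  then have pk: "pack P"
    by (simp add: maximal_pack_def)
  have W: "x \<in> E `` P" "x' \<in> E `` P"
    using P(1) e adj_sym by blast+
  obtain y where y: "(x, y) \<in> E" "y \<notin> P" "y \<notin> E `` P" "N y \<inter> E `` P = {x}"
    using matched_private_neighbour[OF P(2) W e(2)] .
  have "p \<noteq> x'" "y \<noteq> p" "y \<noteq> x'"
    using packD(1)[OF pk, of p] P(1) W(2) y(2,3) by auto
  moreover have "N x = {p, x', y}"
    by (rule N_subset3) (use calculation e y(1) in auto)
  moreover have "(p, y) \<notin> E"
    using y(3) P(1) by auto
  moreover have "far E y q"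
  proof -
    have "N q \<subseteq> E `` P"
      using P(1) by auto
    then have "N y \<inter> N q \<subseteq> {x}"
      using y(4) by auto
    moreover have "x \<notin> N q"
      using pq e(1) adj_sym by (auto simp: far_def)
    moreover have "(y, q) \<notin> E"
      using y(3) P(1) adj_sym by blast
    ultimately show ?thesis
      using y(2) P(1) by (auto simp: far_def)
  qed
  ultimately show ?thesis
    using that by blast
qed

section \<open>Good edges and their propagation\<close>

text \<open>
  An edge is good if it behaves like the middle edge of every path of length 3 in a graph of
  girth at least 6.
\<close>

definition good :: "'a \<Rightarrow> 'a \<Rightarrow> bool" where
  "good x x' \<longleftrightarrow> (x, x') \<in> E \<and> (\<forall>a\<in>N x - {x'}. \<forall>b\<in>N x' - {x}. far E a b)
    \<and> (\<forall>a\<in>N x - {x'}. \<forall>b\<in>N x - {x'}. (a, b) \<notin> E)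
    \<and> (\<forall>a\<in>N x' - {x}. \<forall>b\<in>N x' - {x}. (a, b) \<notin> E)"

lemma good_sym: "good x x' \<Longrightarrow> good x' x"
proof -
  assume g: "good x x'"
  have "(x', x) \<in> E"
    using g adj_sym[of x x'] by (simp add: good_def)
  moreover have "far E a b" if "a \<in> N x' - {x}" "b \<in> N x - {x'}" for a b
    using g that far_sym[of b a] by (simp add: good_def)
  ultimately show ?thesis
    using g by (simp add: good_def)
qed

text \<open>\<open>far_private\<close> is applied along the path, in the opposite direction, and in
  the opposite direction again with \<open>y\<close> in place of \<open>p\<close>. The last two
  applications give the same third neighbour of \<open>x'\<close>, which is therefore far from both
  \<open>p\<close> and \<open>y\<close>.\<close>

lemma goodI:
  assumes pq: "far E p q" and e: "(x, p) \<in> E" "(x, x') \<in> E" "(x', q) \<in> E"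
  shows "good x x'"
proof -
  obtain y where y: "N x = {p, x', y}" "y \<noteq> p" "y \<noteq> x'" "far E y q" "(p, y) \<notin> E"
    using far_private[OF pq e] .
  have xy: "(x, y) \<in> E"
    using y(1) by auto
  obtain y' where y': "N x' = {q, x, y'}" "y' \<noteq> q" "y' \<noteq> x" "far E y' p" "(q, y') \<notin> E"
    using far_private[OF far_sym[OF pq] e(3) adj_sym[OF e(2)] e(1)] .
  obtain z where z: "N x' = {q, x, z}" "z \<noteq> q" "z \<noteq> x" "far E z y" "(q, z) \<notin> E"
    using far_private[OF far_sym[OF y(4)] e(3) adj_sym[OF e(2)] xy] .
  have "z = y'"
    using y'(1,2,3) z by auto
  have "far E p y'" "far E y y'"
    using far_sym[OF y'(4)] far_sym[OF z(4)] \<open>z = y'\<close> by auto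
  moreover have "(y, p) \<notin> E" "(y', q) \<notin> E"
    using y(5) y'(5) adj_sym by blast+
  ultimately show ?thesis
    using y y' pq e(2) by (auto simp: good_def)
qed

text \<open>For another neighbour \<open>u\<close> of \<open>p\<close>, the path \<open>u\<close>,
  \<open>p\<close>, \<open>x\<close>, \<open>x'\<close> joins far vertices, so \<open>goodI\<close>
  applies to its middle edge. A shortcut would bring \<open>p\<close> within distance 2 of a
  neighbour of \<open>x'\<close> other than \<open>x\<close>, or close a triangle at
  \<open>x\<close>.\<close>

lemma good_step:
  assumes g: "good x x'" and p: "(x, p) \<in> E" "p \<noteq> x'"
  shows "good p x"
proof -
  have e: "(x, x') \<in> E"
    using g by (simp add: good_def)
  obtain u v where u: "N p = {x, u, v}" "x \<noteq> u"
    using nbrs_other2[OF adj_sym[OF p(1)]] by metis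
  have pu: "(p, u) \<in> E"
    using u(1) by auto
  have farp: "far E p b" if "b \<in> N x' - {x}" for b
    using g p that by (auto simp: good_def)
  have "far E u x'"
    unfolding far_def
  proof (intro conjI)
    show "u \<noteq> x'"
      using farp[of p] adj_sym[OF pu] p(1) by (cases "p = x") (auto simp: far_def)
    then have "(p, u) \<notin> E \<or> u \<notin> N x - {x'}"
      using g p by (auto simp: good_def)
    then have xu: "(x, u) \<notin> E"
      using pu \<open>u \<noteq> x'\<close> by auto
    show "(u, x') \<notin> E"
      using farp[of u] pu u(2) adj_sym by (auto simp: far_def)
    show "N u \<inter> N x' = {}"
    proof (rule ccontr)
      assume "N u \<inter> N x' \<noteq> {}"
      then obtain t where t: "(u, t) \<in> E" "(x', t) \<in> E" by auto
      then have "t \<noteq> x"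
        using xu adj_sym by auto
      then show False
        using farp[of t] t pu adj_sym[OF t(1)] by (auto simp: far_def)
    qed
  qed
  then show ?thesis
    using goodI[of u x' p x] pu adj_sym[OF p(1)] e by blast
qed

text \<open>An edge leaving the set of vertices that are not far from \<open>p\<close> ends a path
  of length 3 to a far vertex, which gives one good edge. By \<open>good_step\<close> all edges at
  its ends are good, and connectedness carries this everywhere.\<close>

lemma all_good:
  assumes pq: "far E p q" "p \<in> V" "q \<in> V" and e: "(u, v) \<in> E"
  shows "good u v"
proof -
  have "\<exists>x x'. good x x'"
  proof -
    let ?S = "{v\<in>V. \<not> far E p v}"
    have "p \<in> ?S"
      using pq by (auto simp: far_def)
    then have "\<not> E `` ?S \<subseteq> ?S"
      using connected[of ?S] pq by auto
    then obtain v w where vw: "v \<in> V" "\<not> far E p v" "(v, w) \<in> E" "far E p w"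
      using adj_in_V by auto
    then have "v \<noteq> p" "(p, v) \<notin> E"
      using adj_sym by (auto simp: far_def)
    then obtain x where "(p, x) \<in> E" "(v, x) \<in> E"
      using vw(2) by (auto simp: far_def)
    then show ?thesis
      using goodI[OF vw(4), of x v] vw(3) adj_sym by blast
  qed
  then obtain x x' where g: "good x x'" by blast
  let ?S = "{v\<in>V. \<forall>w\<in>N v. good v w}"
  have step: "a \<in> ?S" if "good a b" for a b
  proof -
    have "a \<in> V"
      using that adj_in_V by (auto simp: good_def)
    moreover have "good a w" if "w \<in> N a" for w
      using good_step[OF \<open>good a b\<close>, of w] that good_sym \<open>good a b\<close> by (cases "w = b") auto
    ultimately show ?thesis by blast
  qed
  have "E `` ?S \<subseteq> ?S"
  proof
    fix w assume "w \<in> E `` ?S"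
    then obtain v where "good v w"
      by auto
    then show "w \<in> ?S"
      using step good_sym by blast
  qed
  moreover have "?S \<noteq> {}"
    using step[OF g] by blast
  ultimately have "?S = V"
    by (intro connected) auto
  then show ?thesis
    using e adj_in_V[OF e] by blast
qed

lemma farD:
  assumes "far E u v"
  shows "u \<noteq> v" "(u, v) \<notin> E" "(u, z) \<in> E \<Longrightarrow> (v, z) \<notin> E"
  using assms by (auto simp: far_def)

section \<open>Girth at least 6 and the Heawood graph\<close>

context
  fixes p q
  assumes pq: "far E p q" "p \<in> V" "q \<in> V"
begin

lemma path_far:
  assumes "(a, b) \<in> E" "(b, c) \<in> E" "(c, d) \<in> E" "a \<noteq> c" "b \<noteq> d"
  shows "far E a d"
proof -
  have "good b c"
    using all_good[OF pq assms(2)] .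
  then show ?thesis
    using adj_sym[OF assms(1)] assms(3-5) unfolding good_def by blast
qed

lemma no_triangle:
  assumes "(a, b) \<in> E" "(b, c) \<in> E" "(c, a) \<in> E"
  shows False
proof -
  have "a \<noteq> c" "b \<noteq> a"
    using assms by auto
  then have "far E a a"
    using path_far[OF assms] by simp
  then show False
    by (simp add: far_def)
qed

lemma no_4_cycle:
  assumes "(a, b) \<in> E" "(b, c) \<in> E" "(c, d) \<in> E" "(d, a) \<in> E" "a \<noteq> c" "b \<noteq> d"
  shows False
  using farD(2)[OF path_far[OF assms(1-3,5,6)]] adj_sym[OF assms(4)] by blast

lemma no_5_cycle:
  assumes "(a, b) \<in> E" "(b, c) \<in> E" "(c, d) \<in> E" "(d, e) \<in> E" "(e, a) \<in> E" "a \<noteq> c" "b \<noteq> d"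
  shows False
  using farD(3)[OF path_far[OF assms(1-3,6,7)] adj_sym[OF assms(5)]] assms(4) by blast

text \<open>Otherwise \<open>c\<close>, \<open>u\<close>, \<open>w\<close> extend to a packing for
  which \<open>a\<close>, \<open>b\<close> and \<open>x\<close> lie in W. Being matched to
  \<open>a\<close>, the vertex \<open>x\<close> needs a neighbour outside \<open>P\<close> and W,
  but its neighbours are \<open>a\<close>, \<open>b\<close>, \<open>c\<close>.\<close>

lemma common_child_neighbour:
  assumes x: "N x = {a, b, c}" "a \<noteq> b" "a \<noteq> c" "b \<noteq> c" and u: "(a, u) \<in> E" "u \<noteq> x"
    and w: "(b, w) \<in> E" "w \<noteq> x"
  shows "\<exists>t. (u, t) \<in> E \<and> (w, t) \<in> E"
proof (rule ccontr)
  assume none: "\<nexists>t. (u, t) \<in> E \<and> (w, t) \<in> E"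
  have xa: "(x, a) \<in> E" "(x, b) \<in> E" "(x, c) \<in> E"
    using x(1) by auto
  note ax = xa[THEN adj_sym]
  have *: "far E c u" "far E c w" "far E u b"
    using path_far[OF ax(3) xa(1) u(1)] path_far[OF ax(3) xa(2) w(1)]
      path_far[OF adj_sym[OF u(1)] ax(1) xa(2)] x(2-4) u(2) w(2) by auto
  have "u \<noteq> w" "(u, w) \<notin> E"
    using *(3) adj_sym[OF w(1)] w(1) by (auto simp: far_def)
  then have "far E u w"
    using none by (auto simp: far_def)
  with * have "pack {c, u, w}"
    using far_sym[of c u] far_sym[of c w] far_sym[of u w] adj_in_V[OF u(1)] adj_in_V[OF w(1)]
      adj_in_V[OF xa(3)] by (auto simp: pack_def pairwise_insert)
  then obtain P where P: "{c, u, w} \<subseteq> P" "maximal_pack P"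
    by (rule extend_pack)
  have W: "a \<in> E `` P" "b \<in> E `` P" "x \<in> E `` P"
    using P(1) adj_sym[OF u(1)] adj_sym[OF w(1)] ax(3) by blast+
  obtain y where "(x, y) \<in> E" "y \<notin> P" "y \<notin> E `` P" "N y \<inter> E `` P = {x}"
    using matched_private_neighbour[OF P(2) W(3,1) xa(1)] .
  then show False
    using x(1) P(1) W by auto
qed

lemma no_far_pair: False
proof -
  have unique: "s = t" if "(u, s) \<in> E" "(w, s) \<in> E" "(u, t) \<in> E" "(w, t) \<in> E" "u \<noteq> w" for u w s t
    using no_4_cycle[OF that(1) adj_sym[OF that(2)] that(4) adj_sym[OF that(3)] that(5)] by blast
  have iff: "(v, t) \<in> E \<longleftrightarrow> t \<in> S" if "N v = S" for v t S
    using that by auto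
  have nac: "(c, a) \<notin> E" if "(a, c) \<notin> E" for a c
    using that adj_sym by blast
  obtain a1 a2 a3 where x: "N p = {a1, a2, a3}" "a1 \<noteq> a2" "a1 \<noteq> a3" "a2 \<noteq> a3"
    using cubic[OF pq(2)] by (auto simp: card_3_iff)
  \<comment> \<open>The graph is laid out by distance from \<open>p\<close>, now called
    \<open>x\<close>: children \<open>a1\<close>, \<open>a2\<close>, \<open>a3\<close>;
    grandchildren with prefix \<open>c\<close> (at first \<open>b1\<close>, \<open>b2\<close> below
    \<open>a3\<close>); last level \<open>d1\<close>, \<open>d2\<close>, \<open>e1\<close>,
    \<open>e2\<close>.\<close>
  define x where "x = p"
  note x = x[folded x_def]
  have x': "N x = {a1, a3, a2}" "N x = {a2, a3, a1}"
    using x(1) by auto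
  have xa: "(x, a1) \<in> E" "(x, a2) \<in> E" "(x, a3) \<in> E"
    using x(1) by auto
  note ax = xa[THEN adj_sym]
  obtain c11 c12 where c1: "N a1 = {x, c11, c12}" "x \<noteq> c11" "x \<noteq> c12" "c11 \<noteq> c12"
    using nbrs_other2[OF ax(1)] .
  obtain c21 c22 where c2: "N a2 = {x, c21, c22}" "x \<noteq> c21" "x \<noteq> c22" "c21 \<noteq> c22"
    using nbrs_other2[OF ax(2)] .
  obtain b1 b2 where b: "N a3 = {x, b1, b2}" "x \<noteq> b1" "x \<noteq> b2" "b1 \<noteq> b2"
    using nbrs_other2[OF ax(3)] .
  have ac: "(a1, c11) \<in> E" "(a1, c12) \<in> E" "(a2, c21) \<in> E" "(a2, c22) \<in> E" "(a3, b1) \<in> E" "(a3, b2) \<in> E"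
    by (simp_all add: iff[OF c1(1)] iff[OF c2(1)] iff[OF b(1)])
  note ca = ac[THEN adj_sym]
  have across: "(a, c) \<notin> E" if "(x, a) \<in> E" "(x, a') \<in> E" "(a', c) \<in> E" "x \<noteq> c" "a \<noteq> a'" for a a' c
    using no_4_cycle[OF that(1) _ adj_sym[OF that(3)] adj_sym[OF that(2)] that(4,5)] by blast
  have na: "(a1, c21) \<notin> E" "(a1, c22) \<notin> E" "(a1, b1) \<notin> E" "(a1, b2) \<notin> E"
    "(a2, c11) \<notin> E" "(a2, c12) \<notin> E" "(a2, b1) \<notin> E" "(a2, b2) \<notin> E"
    "(a3, c11) \<notin> E" "(a3, c12) \<notin> E" "(a3, c21) \<notin> E" "(a3, c22) \<notin> E"
    using across[OF xa(1,2) ac(3)] across[OF xa(1,2) ac(4)] across[OF xa(1,3) ac(5)] across[OF xa(1,3) ac(6)]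
      across[OF xa(2,1) ac(1)] across[OF xa(2,1) ac(2)] across[OF xa(2,3) ac(5)] across[OF xa(2,3) ac(6)]
      across[OF xa(3,1) ac(1)] across[OF xa(3,1) ac(2)] across[OF xa(3,2) ac(3)] across[OF xa(3,2) ac(4)]
      x(2-4) c1(2,3) c2(2,3) b(2,3) by simp_all
  note na' = na[THEN nac]
  \<comment> \<open>One vertex for each pair of a grandchild below \<open>a1\<close> and one below
    \<open>a2\<close>. A coincidence would give two siblings a second common neighbour, hence a
    4-cycle.\<close>
  obtain d1 where d1: "(c11, d1) \<in> E" "(c21, d1) \<in> E"
    using common_child_neighbour[OF x ac(1) c1(2)[symmetric] ac(3) c2(2)[symmetric]] by blast
  obtain d2 where d2: "(c11, d2) \<in> E" "(c22, d2) \<in> E"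
    using common_child_neighbour[OF x ac(1) c1(2)[symmetric] ac(4) c2(3)[symmetric]] by blast
  obtain e1 where e1: "(c12, e1) \<in> E" "(c21, e1) \<in> E"
    using common_child_neighbour[OF x ac(2) c1(3)[symmetric] ac(3) c2(2)[symmetric]] by blast
  obtain e2 where e2: "(c12, e2) \<in> E" "(c22, e2) \<in> E"
    using common_child_neighbour[OF x ac(2) c1(3)[symmetric] ac(4) c2(3)[symmetric]] by blast
  have nd: "d1 \<noteq> a1" "d1 \<noteq> a2" "d1 \<noteq> a3" "d2 \<noteq> a1" "d2 \<noteq> a2" "d2 \<noteq> a3"
    "e1 \<noteq> a1" "e1 \<noteq> a2" "e1 \<noteq> a3" "e2 \<noteq> a1" "e2 \<noteq> a2" "e2 \<noteq> a3"
    using d1 d2 e1 e2 na' by blast+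
  have de: "d1 \<noteq> d2" "e1 \<noteq> e2" "d1 \<noteq> e1" "d2 \<noteq> e2" "d1 \<noteq> e2" "d2 \<noteq> e1"
    using unique[OF d1(2) _ ca(3,4) c2(4)] unique[OF e1(2) _ ca(3,4) c2(4)]
      unique[OF d1(1) _ ca(1,2) c1(4)] unique[OF d2(1) _ ca(1,2) c1(4)] d2 e1 e2 nd by blast+
  have Nc11: "N c11 = {a1, d1, d2}"
    by (rule N_subset3) (use ca d1 d2 nd de in simp_all)
  have Nc12: "N c12 = {a1, e1, e2}"
    by (rule N_subset3) (use ca e1 e2 nd de in simp_all)
  have Nc21: "N c21 = {a2, d1, e1}"
    by (rule N_subset3) (use ca d1 e1 nd de in simp_all)
  have Nc22: "N c22 = {a2, d2, e2}"
    by (rule N_subset3) (use ca d2 e2 nd de in simp_all)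
  \<comment> \<open>A child of \<open>a3\<close> shares a neighbour with each of the four
    grandchildren below \<open>a1\<close> and \<open>a2\<close>, so it meets both rows and both
    columns of the square \<open>d1\<close>, \<open>d2\<close>; \<open>e1\<close>,
    \<open>e2\<close>.\<close>
  have dd: "(b, d1) \<in> E \<or> (b, d2) \<in> E" "(b, e1) \<in> E \<or> (b, e2) \<in> E"
    "(b, d1) \<in> E \<or> (b, e1) \<in> E" "(b, d2) \<in> E \<or> (b, e2) \<in> E"
    if "(a3, b) \<in> E" "b \<noteq> x" "(a1, b) \<notin> E" "(a2, b) \<notin> E" for b
    using common_child_neighbour[OF x'(1) x(3) x(2) x(4)[symmetric] ac(1) c1(2)[symmetric] that(1,2)]
      common_child_neighbour[OF x'(1) x(3) x(2) x(4)[symmetric] ac(2) c1(3)[symmetric] that(1,2)]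
      common_child_neighbour[OF x'(2) x(4) x(2)[symmetric] x(3)[symmetric] ac(3) c2(2)[symmetric] that(1,2)]
      common_child_neighbour[OF x'(2) x(4) x(2)[symmetric] x(3)[symmetric] ac(4) c2(3)[symmetric] that(1,2)]
      nac[OF that(3)] nac[OF that(4)]
    unfolding iff[OF Nc11] iff[OF Nc12] iff[OF Nc21] iff[OF Nc22] by blast+
  have noshare: "\<not> ((b1, t) \<in> E \<and> (b2, t) \<in> E)" if "t \<noteq> a3" for t
    using unique[OF _ _ ca(5,6) b(4), of t] that by blast
  note dd1 = dd[OF ac(5) b(2)[symmetric] na(3,7)] and dd2 = dd[OF ac(6) b(3)[symmetric] na(4,8)]
  \<comment> \<open>As \<open>b1\<close> and \<open>b2\<close> share only \<open>a3\<close>, they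
    take opposite diagonals of the square, and the new names record which.\<close>
  obtain c31 c32 where c3: "N a3 = {x, c31, c32}" "x \<noteq> c31" "x \<noteq> c32" "c31 \<noteq> c32"
    "(c31, d1) \<in> E" "(c31, e2) \<in> E" "(c32, d2) \<in> E" "(c32, e1) \<in> E"
    "(a1, c31) \<notin> E" "(a1, c32) \<notin> E" "(a2, c31) \<notin> E" "(a2, c32) \<notin> E"
  proof (cases "(b1, d1) \<in> E")
    case True
    then have "(b2, d2) \<in> E" "(b2, e1) \<in> E" "(b1, e2) \<in> E"
      using dd1 dd2 noshare nd by blast+
    then show ?thesis
      using that[of b1 b2] b True na by simp
  next
    case False
    then have "(b1, d2) \<in> E" "(b1, e1) \<in> E" "(b2, d1) \<in> E" "(b2, e2) \<in> E"
      using dd1 dd2 noshare nd by blast+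
    then show ?thesis
      using that[of b2 b1] b na by (simp add: insert_commute)
  qed
  have ac3: "(a3, c31) \<in> E" "(a3, c32) \<in> E"
    by (simp_all add: iff[OF c3(1)])
  note ca3 = ac3[THEN adj_sym]
  have Nc31: "N c31 = {a3, d1, e2}"
    by (rule N_subset3) (use ca3 c3 nd de in simp_all)
  have Nc32: "N c32 = {a3, d2, e1}"
    by (rule N_subset3) (use ca3 c3 nd de in simp_all)
  have cne: "c11 \<noteq> c21" "c11 \<noteq> c31" "c21 \<noteq> c31" "c11 \<noteq> c22" "c11 \<noteq> c32" "c22 \<noteq> c32"
    "c12 \<noteq> c21" "c12 \<noteq> c32" "c21 \<noteq> c32" "c12 \<noteq> c22" "c12 \<noteq> c31" "c22 \<noteq> c31"
    using na ac c3(9-12) by blast+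
  note cd = d1[THEN adj_sym] d2[THEN adj_sym] e1[THEN adj_sym] e2[THEN adj_sym] c3(5-8)[THEN adj_sym]
  have Nd1: "N d1 = {c11, c21, c31}"
    by (rule N_subset3) (use cd cne in simp_all)
  have Nd2: "N d2 = {c11, c22, c32}"
    by (rule N_subset3) (use cd cne in simp_all)
  have Ne1: "N e1 = {c12, c21, c32}"
    by (rule N_subset3) (use cd cne in simp_all)
  have Ne2: "N e2 = {c12, c22, c31}"
    by (rule N_subset3) (use cd cne in simp_all)
  let ?S = "{x, a1, a2, a3, c11, c12, c21, c22, c31, c32, d1, d2, e1, e2}"
  note adj = iff[OF x(1)] iff[OF c1(1)] iff[OF c2(1)] iff[OF c3(1)] iff[OF Nc11] iff[OF Nc12]
    iff[OF Nc21] iff[OF Nc22] iff[OF Nc31] iff[OF Nc32] iff[OF Nd1] iff[OF Nd2] iff[OF Ne1] iff[OF Ne2]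
  have SV: "?S \<subseteq> V"
    using xa[THEN adj_in_V(2)] xa(1)[THEN adj_in_V(1)] ac[THEN adj_in_V(2)] ac3[THEN adj_in_V(2)]
      cd[THEN adj_in_V(1)] by simp
  have "E `` ?S \<subseteq> ?S"
    by (auto simp: adj)
  then have V: "?S = V"
    using connected[OF SV] by simp
  \<comment> \<open>\<open>x\<close> dominates its children, \<open>d1\<close> dominates
    \<open>c11\<close>, \<open>c21\<close>, \<open>c31\<close>, and the other three dominate
    \<open>d2\<close>, \<open>e1\<close>, \<open>e2\<close>. Size 5 forces \<open>r\<close> to be at
    most 1, which the packing of \<open>p\<close> and \<open>q\<close> exceeds.\<close>
  let ?D = "{x, d1, c12, c22, c32}"
  have xc: "(x, c12) \<notin> E" "(x, c22) \<notin> E" "(x, c32) \<notin> E"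
    using no_triangle[OF xa(1) ac(2)] no_triangle[OF xa(2) ac(4)] no_triangle[OF xa(3) ac3(2)] nac by blast+
  have cc: "(c, c') \<notin> E" "(c', c) \<notin> E"
    if "(x, a) \<in> E" "(x, a') \<in> E" "(a, c) \<in> E" "(a', c') \<in> E" "x \<noteq> c" for a a' c c'
  proof -
    have "a \<noteq> c'"
      using no_triangle[OF that(2) _ adj_sym[OF that(1)]] that(4) by blast
    then show "(c, c') \<notin> E"
      using no_5_cycle[OF that(1,3) _ adj_sym[OF that(4)] adj_sym[OF that(2)] that(5)] by blast
    then show "(c', c) \<notin> E"
      by (rule nac)
  qed
  have "(u, v) \<notin> E" if "u \<in> ?D" "v \<in> ?D" for u v
  proof -
    have "(x, d1) \<notin> E"
      using nd by (simp add: iff[OF x(1)])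
    moreover have "(d1, c12) \<notin> E" "(d1, c22) \<notin> E" "(d1, c32) \<notin> E"
      using cne c1(4) c2(4) c3(4) by (simp_all add: iff[OF Nd1])
    ultimately show ?thesis
      using that xc xc[THEN nac] nac[of x d1] nac[of d1]
        cc[OF xa(1,2) ac(2,4) c1(3)] cc[OF xa(1,3) ac(2) ac3(2) c1(3)] cc[OF xa(2,3) ac(4) ac3(2) c2(3)]
      by fastforce
  qed
  then have "E `` ?D \<inter> ?D = {}"
    by blast
  moreover have "V \<subseteq> ?D \<union> E `` ?D"
    unfolding V[symmetric] by (simp add: Image_iff adj)
  ultimately have "indep_dom ?D"
    using SV by (simp add: indep_dom_def)
  then have "3 * r \<le> card ?D"
    by (rule card_indep_dom_ge)
  also have "\<dots> \<le> 5"
    using card_length[of "[x, d1, c12, c22, c32]"] by simp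
  finally have "r \<le> 1" by simp
  moreover have "pack {p, q}" "p \<noteq> q"
    using pq far_sym[OF pq(1)] by (auto simp: pack_def pairwise_def far_def)
  ultimately show False
    using card_pack_le[of "{p, q}"] by simp
qed

end

end

section \<open>The four extremal graphs\<close>

text \<open>These properties give packing number 1 and independent domination number 3: the order
  excludes a single dominating vertex, the last inequality a dominating pair. They are decided by
  simplification on explicit neighbourhoods and pass to isomorphic graphs.\<close>

definition diameter_two_cubic :: "'a set \<Rightarrow> 'a rel \<Rightarrow> bool" where
  "diameter_two_cubic V E \<longleftrightarrow> 4 < card V \<and> (\<forall>u\<in>V. card (E `` {u}) = 3 \<and> (\<forall>v\<in>V. \<not> far E u v \<and>
     (u \<noteq> v \<longrightarrow> v \<notin> E `` {u} \<longrightarrow> card (E `` {u} \<union> E `` {v}) + 2 < card V)))"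

lemma far_iff: "far E u v \<longleftrightarrow> u \<noteq> v \<and> v \<notin> E `` {u} \<and> E `` {u} \<inter> E `` {v} = {}"
  by (simp add: far_def)

lemma verts_undirected [simp]: "pverts (undirected V F) = V"
  by (simp add: undirected_def)

lemma nbrs_undirected_empty: "parcs (undirected V {}) `` {v} = {}"
  by (simp add: undirected_def)

text \<open>As a rewrite rule, this computes neighbourhoods from an explicit edge list.\<close>

lemma nbrs_undirected_insert:
  "parcs (undirected V (insert (a, b) F)) `` {v} =
    (if v = a then {b} else {}) \<union> (if v = b then {a} else {}) \<union> parcs (undirected V F) `` {v}"
  by (auto simp: undirected_def)

lemmas nbrs_undirected = nbrs_undirected_empty nbrs_undirected_insert

lemma verts_H1: "pverts H1 = {1, 2, 3, 4, 5, 6, 7, 8}"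
  by (auto simp: H1_def)

lemma verts_H2: "pverts H2 = {1, 2, 3, 4, 5, 6}"
  by (auto simp: H2_def)

lemma verts_H3: "pverts H3 = {1, 2, 3, 4, 5, 6, 7, 8}"
  by (auto simp: H3_def)

lemma verts_H4:
  "pverts H4 = {Inl 0, Inl 1, Inl 2, Inl 3, Inl 4, Inr 0, Inr 1, Inr 2, Inr 3, Inr 4}"
  by (auto simp: H4_def)

lemma lessThan_5: "{..<5 :: nat} = {0, 1, 2, 3, 4}" by auto

lemma H2_eq: "H2 = undirected {1..6} {(1,4), (1,5), (1,6), (2,4), (2,5), (2,6), (3,4), (3,5), (3,6)}"
proof -
  have "{1..3::nat} = {1,2,3}" "{4..6::nat} = {4,5,6}" by auto
  then show ?thesis by (simp add: H2_def insert_Times_insert)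
qed

lemma nbrs_H1:
  "parcs H1 `` {1} = {2, 3, 8}"
  "parcs H1 `` {2} = {1, 3, 6}"
  "parcs H1 `` {3} = {1, 2, 4}"
  "parcs H1 `` {4} = {3, 5, 7}"
  "parcs H1 `` {5} = {4, 6, 8}"
  "parcs H1 `` {6} = {2, 5, 7}"
  "parcs H1 `` {7} = {4, 6, 8}"
  "parcs H1 `` {8} = {1, 5, 7}"
  by (simp_all add: H1_def cycle8_def nbrs_undirected insert_commute del: Image_singleton_iff One_nat_def)

lemma nbrs_H2:
  "parcs H2 `` {1} = {4, 5, 6}"
  "parcs H2 `` {2} = {4, 5, 6}"
  "parcs H2 `` {3} = {4, 5, 6}"
  "parcs H2 `` {4} = {1, 2, 3}"
  "parcs H2 `` {5} = {1, 2, 3}"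
  "parcs H2 `` {6} = {1, 2, 3}"
  by (simp_all add: H2_eq nbrs_undirected insert_commute del: Image_singleton_iff One_nat_def)

lemma nbrs_H3:
  "parcs H3 `` {1} = {2, 5, 8}"
  "parcs H3 `` {2} = {1, 3, 6}"
  "parcs H3 `` {3} = {2, 4, 7}"
  "parcs H3 `` {4} = {3, 5, 8}"
  "parcs H3 `` {5} = {1, 4, 6}"
  "parcs H3 `` {6} = {2, 5, 7}"
  "parcs H3 `` {7} = {3, 6, 8}"
  "parcs H3 `` {8} = {1, 4, 7}"
  by (simp_all add: H3_def cycle8_def nbrs_undirected insert_commute del: Image_singleton_iff One_nat_def)

lemma nbrs_H4:
  "parcs H4 `` {Inl 0} = {Inl 1, Inl 4, Inr 0}"
  "parcs H4 `` {Inl 1} = {Inl 0, Inl 2, Inr 1}"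
  "parcs H4 `` {Inl 2} = {Inl 1, Inl 3, Inr 2}"
  "parcs H4 `` {Inl 3} = {Inl 2, Inl 4, Inr 3}"
  "parcs H4 `` {Inl 4} = {Inl 0, Inl 3, Inr 4}"
  "parcs H4 `` {Inr 0} = {Inl 0, Inr 2, Inr 3}"
  "parcs H4 `` {Inr 1} = {Inl 1, Inr 3, Inr 4}"
  "parcs H4 `` {Inr 2} = {Inl 2, Inr 0, Inr 4}"
  "parcs H4 `` {Inr 3} = {Inl 3, Inr 0, Inr 1}"
  "parcs H4 `` {Inr 4} = {Inl 4, Inr 1, Inr 2}"
  by (simp_all add: H4_def lessThan_5 nbrs_undirected insert_commute One_nat_def[symmetric] del: Image_singleton_iff One_nat_def)

lemma diameter_two_cubic_H1: "diameter_two_cubic (pverts H1) (parcs H1)"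
  unfolding diameter_two_cubic_def far_iff verts_H1
  by (simp add: nbrs_H1 card_insert_if del: Image_singleton_iff One_nat_def)

lemma diameter_two_cubic_H2: "diameter_two_cubic (pverts H2) (parcs H2)"
  unfolding diameter_two_cubic_def far_iff verts_H2
  by (simp add: nbrs_H2 card_insert_if del: Image_singleton_iff One_nat_def)

lemma diameter_two_cubic_H3: "diameter_two_cubic (pverts H3) (parcs H3)"
  unfolding diameter_two_cubic_def far_iff verts_H3
  by (simp add: nbrs_H3 card_insert_if del: Image_singleton_iff One_nat_def)

lemma diameter_two_cubic_H4: "diameter_two_cubic (pverts H4) (parcs H4)"
  unfolding diameter_two_cubic_def far_iff verts_H4
  by (simp add: nbrs_H4 card_insert_if del: Image_singleton_iff One_nat_def)

text \<open>
  This is isomorphism expressed by a map on vertices only, without the record of the library.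
\<close>

definition graph_copy :: "'b pair_pre_digraph \<Rightarrow> 'a set \<Rightarrow> 'a rel \<Rightarrow> bool" where
  "graph_copy H V E \<longleftrightarrow>
    (\<exists>g. inj_on g (pverts H) \<and> V = g ` pverts H \<and> E = map_prod g g ` parcs H)"

lemma inj_on_nth_comp:
  assumes "distinct xs" "inj_on h A" "\<And>a. a \<in> A \<Longrightarrow> h a < length xs"
  shows "inj_on (\<lambda>a. xs ! h a) A"
  using assms by (auto simp: inj_on_def nth_eq_iff_index_eq)

section \<open>Classification in diameter two\<close>

context tight_graph
begin

text \<open>An injective homomorphism from a cubic graph into a subcubic one maps neighbourhoods
  onto neighbourhoods. Its image is thus closed, hence all of \<open>V\<close>, and no edge is left
  over. Only the listed edges remain to be checked.\<close>

lemma graph_copy_undirected: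
  assumes H: "H = undirected U F" and inj: "inj_on g U" and U: "U \<noteq> {}" "F \<subseteq> U \<times> U"
    and cubic: "diameter_two_cubic (pverts H) (parcs H)"
    and hom: "\<And>u v. (u, v) \<in> F \<Longrightarrow> (g u, g v) \<in> E"
  shows "graph_copy H V E"
proof -
  have deg: "card (parcs (undirected U F) `` {u}) = 3" if "u \<in> U" for u
    using cubic that by (simp add: diameter_two_cubic_def H)
  let ?F = "parcs (undirected U F)"
  have F: "?F \<subseteq> U \<times> U"
    using U(2) by (auto simp: undirected_def)
  have hom': "(g u, g v) \<in> E" if "(u, v) \<in> ?F" for u v
    using that hom adj_sym by (auto simp: undirected_def)
  have N: "N (g u) = g ` (?F `` {u})" if "u \<in> U" for u
  proof -
    have "card (g ` (?F `` {u})) = 3"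
      using deg[OF that] inj F by (subst card_image) (auto intro: inj_on_subset)
    moreover have "g ` (?F `` {u}) \<subseteq> N (g u)"
      using hom' by auto
    ultimately show ?thesis
      using card_seteq[of "N (g u)" "g ` (?F `` {u})"] degree_le[of "g u"] by simp
  qed
  have "g u \<in> V" if "u \<in> U" for u
  proof -
    have "N (g u) \<noteq> {}"
      using N[OF that] deg[OF that] by auto
    then show ?thesis
      using adj_in_V by auto
  qed
  then have "g ` U \<subseteq> V"
    by auto
  moreover have "E `` (g ` U) \<subseteq> g ` U"
  proof
    fix w assume "w \<in> E `` (g ` U)"
    then obtain u where "u \<in> U" "w \<in> N (g u)"
      by auto
    then show "w \<in> g ` U"
      using N[of u] F by auto
  qed
  ultimately have V: "g ` U = V"
    using connected U(1) by simp
  have "E \<subseteq> map_prod g g ` ?F"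
  proof
    fix e assume "e \<in> E"
    then obtain a b where e: "e = (a, b)" "(a, b) \<in> E"
      by (cases e) auto
    then obtain u where u: "u \<in> U" "a = g u"
      using V adj_in_V(1)[OF e(2)] by auto
    then have "b \<in> g ` (?F `` {u})"
      using N[OF u(1)] e(2) by auto
    then show "e \<in> map_prod g g ` ?F"
      using e(1) u(2) by force
  qed
  then have "E = map_prod g g ` ?F"
    using hom' by auto
  then show ?thesis
    using inj V by (auto simp: graph_copy_def H)
qed

lemma graph_copy_H1:
  assumes "distinct [p1, p2, p3, p4, p5, p6, p7, p8]"
    and "(p1, p2) \<in> E" "(p2, p3) \<in> E" "(p3, p4) \<in> E" "(p4, p5) \<in> E"
    and "(p5, p6) \<in> E" "(p6, p7) \<in> E" "(p7, p8) \<in> E" "(p8, p1) \<in> E"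
    and "(p1, p3) \<in> E" "(p2, p6) \<in> E" "(p4, p7) \<in> E" "(p5, p8) \<in> E"
  shows "graph_copy H1 V E"
proof (rule graph_copy_undirected[OF H1_def _ _ _ diameter_two_cubic_H1, where g = "\<lambda>i. [p1, p2, p3, p4, p5, p6, p7, p8] ! (i - 1)"])
  show "inj_on (\<lambda>i. [p1, p2, p3, p4, p5, p6, p7, p8] ! (i - 1)) {1..8}"
    by (rule inj_on_nth_comp[OF assms(1)]) (auto simp: inj_on_def)
qed (use assms in \<open>auto simp: cycle8_def\<close>)

lemma graph_copy_H2:
  assumes "distinct [v1, v2, v3, w1, w2, w3]" and "{v1, v2, v3} \<times> {w1, w2, w3} \<subseteq> E"
  shows "graph_copy H2 V E"
proof (rule graph_copy_undirected[OF H2_eq _ _ _ diameter_two_cubic_H2, where g = "\<lambda>i. [v1, v2, v3, w1, w2, w3] ! (i - 1)"])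
  show "inj_on (\<lambda>i. [v1, v2, v3, w1, w2, w3] ! (i - 1)) {1..6}"
    by (rule inj_on_nth_comp[OF assms(1)]) (auto simp: inj_on_def)
qed (use assms in auto)

lemma graph_copy_H3:
  assumes "distinct [p1, p2, p3, p4, p5, p6, p7, p8]"
    and "(p1, p2) \<in> E" "(p2, p3) \<in> E" "(p3, p4) \<in> E" "(p4, p5) \<in> E"
    and "(p5, p6) \<in> E" "(p6, p7) \<in> E" "(p7, p8) \<in> E" "(p8, p1) \<in> E"
    and "(p1, p5) \<in> E" "(p2, p6) \<in> E" "(p3, p7) \<in> E" "(p4, p8) \<in> E"
  shows "graph_copy H3 V E"
proof (rule graph_copy_undirected[OF H3_def _ _ _ diameter_two_cubic_H3, where g = "\<lambda>i. [p1, p2, p3, p4, p5, p6, p7, p8] ! (i - 1)"])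
  show "inj_on (\<lambda>i. [p1, p2, p3, p4, p5, p6, p7, p8] ! (i - 1)) {1..8}"
    by (rule inj_on_nth_comp[OF assms(1)]) (auto simp: inj_on_def)
qed (use assms in \<open>auto simp: cycle8_def\<close>)

lemma graph_copy_H4:
  assumes "distinct [p0, p1, p2, p3, p4, q0, q1, q2, q3, q4]"
    and "(p0, p1) \<in> E" "(p1, p2) \<in> E" "(p2, p3) \<in> E" "(p3, p4) \<in> E" "(p4, p0) \<in> E"
    and "(p0, q0) \<in> E" "(p1, q1) \<in> E" "(p2, q2) \<in> E" "(p3, q3) \<in> E" "(p4, q4) \<in> E"
    and "(q0, q2) \<in> E" "(q1, q3) \<in> E" "(q2, q4) \<in> E" "(q3, q0) \<in> E" "(q4, q1) \<in> E"
  shows "graph_copy H4 V E"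
proof (rule graph_copy_undirected[OF H4_def _ _ _ diameter_two_cubic_H4])
  let ?xs = "[p0, p1, p2, p3, p4, q0, q1, q2, q3, q4]"
  let ?g = "\<lambda>v. ?xs ! (case v of Inl j \<Rightarrow> j | Inr j \<Rightarrow> j + 5)"
  let ?F = "\<Union>j<5. {(Inl j, Inl ((j + 1) mod 5)), (Inl j, Inr j), (Inr j, Inr ((j + 2) mod 5 :: nat))}"
  show "inj_on ?g ({..<5} <+> {..<5})"
    by (rule inj_on_nth_comp[OF assms(1)]) (auto simp: inj_on_def)
  show "(?g u, ?g v) \<in> E" if "(u, v) \<in> ?F" for u v
    using that assms(2-) unfolding lessThan_5 by auto
qed (auto simp: lessThan_5)

lemma near:
  assumes "u \<in> V" "v \<in> V" "u \<noteq> v" "(u, v) \<notin> E"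
  obtains t where "(u, t) \<in> E" "(v, t) \<in> E"
proof -
  have "\<not> far E u v"
    using no_far_pair[of u v] assms(1,2) by blast
  then have "N u \<inter> N v \<noteq> {}"
    using assms(3,4) by (simp add: far_def)
  then show ?thesis
    using that by blast
qed

lemma adj_iff: "N v = S \<Longrightarrow> (v, t) \<in> E \<longleftrightarrow> t \<in> S"
  by auto

text \<open>Without far pairs a single vertex \<open>v\<close> is a maximal packing, with W =
  \<open>N v\<close>. The triangle makes \<open>x\<close> and \<open>x'\<close> matched, so
  \<open>matched_private_neighbour\<close> applies.\<close>

lemma triangle_third:
  assumes e: "(v, x) \<in> E" "(x, x') \<in> E" "(x', v) \<in> E"
  obtains y where "N x = {v, x', y}" "y \<noteq> v" "y \<noteq> x'" "(v, y) \<notin> E" "N y \<inter> N v = {x}"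
proof -
  have v: "v \<in> V"
    using e adj_in_V by auto
  then have P: "maximal_pack {v}"
    using no_far_pair v by (auto simp: maximal_pack_def pack_singleton)
  obtain y where y: "(x, y) \<in> E" "y \<notin> {v}" "y \<notin> E `` {v}" "N y \<inter> E `` {v} = {x}"
    using matched_private_neighbour[OF P, of x x'] e(1,2) adj_sym[OF e(3)] by auto
  have ne: "y \<noteq> v" "y \<noteq> x'" "v \<noteq> x'"
    using y(2,3) e(3) adj_sym[OF e(3)] by auto
  have "N x = {v, x', y}"
    by (rule N_subset3) (use e(2) y(1) adj_sym[OF e(1)] ne in simp_all)
  then show ?thesis
    using that ne y by simp
qed

text \<open>The third neighbours \<open>s1\<close>, \<open>s2\<close>, \<open>s3\<close> of the
  triangle are distinct and pairwise non-adjacent by privacy. Distance 2 to the triangle then forces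
  each further neighbour of \<open>s1\<close> to be adjacent to \<open>s2\<close> and
  \<open>s3\<close> as well.\<close>

lemma graph_copy_triangle:
  assumes t: "(t1, t2) \<in> E" "(t2, t3) \<in> E" "(t3, t1) \<in> E"
  shows "graph_copy H1 V E"
proof -
  note t' = t[THEN adj_sym]
  obtain s1 where s1: "N t1 = {t2, t3, s1}" "s1 \<noteq> t2" "s1 \<noteq> t3" "(t2, s1) \<notin> E" "N s1 \<inter> N t2 = {t1}"
    using triangle_third[OF t'(1,3,2)] .
  obtain s2 where s2: "N t2 = {t3, t1, s2}" "s2 \<noteq> t3" "s2 \<noteq> t1" "(t3, s2) \<notin> E" "N s2 \<inter> N t3 = {t2}"
    using triangle_third[OF t'(2,1,3)] .
  obtain s3 where s3: "N t3 = {t1, t2, s3}" "s3 \<noteq> t1" "s3 \<noteq> t2" "(t1, s3) \<notin> E" "N s3 \<inter> N t1 = {t3}"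
    using triangle_third[OF t'(3,2,1)] .
  note T = adj_iff[OF s1(1)] adj_iff[OF s2(1)] adj_iff[OF s3(1)]
  have ts: "(t1, s1) \<in> E" "(t2, s2) \<in> E" "(t3, s3) \<in> E"
    by (simp_all add: T)
  note st = ts[THEN adj_sym]
  have ss: "s1 \<noteq> s2" "s2 \<noteq> s3" "s3 \<noteq> s1"
    using s1(4) s2(4) s3(4) ts by auto
  have ts_ne: "t1 \<noteq> t2" "t2 \<noteq> t3" "t3 \<noteq> t1" "s1 \<noteq> t1" "s2 \<noteq> t2" "s3 \<noteq> t3"
    using t st by auto
  have nss: "(s1, s2) \<notin> E" "(s2, s3) \<notin> E" "(s3, s1) \<notin> E"
  proof -
    show "(s1, s2) \<notin> E"
      using s1(5) ts(2) s2(3) by blast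
    show "(s2, s3) \<notin> E"
      using s2(5) ts(3) s3(3) by blast
    show "(s3, s1) \<notin> E"
      using s3(5) ts(1) s1(3) by blast
  qed
  obtain r1 r2 where r: "N s1 = {t1, r1, r2}" "t1 \<noteq> r1" "t1 \<noteq> r2" "r1 \<noteq> r2"
    using nbrs_other2[OF st(1)] .
  have adj: "(r, s2) \<in> E \<and> (r, s3) \<in> E \<and> r \<noteq> s2 \<and> r \<noteq> s3 \<and> r \<noteq> s1 \<and> r \<noteq> t2 \<and> r \<noteq> t3"
    if r: "(s1, r) \<in> E" "t1 \<noteq> r" for r
  proof -
    have ne: "r \<noteq> s2" "r \<noteq> s3" "r \<noteq> s1"
      using r nss adj_sym[of s1 s3] by auto
    have "r \<noteq> t2"
      using r(1) s1(4) adj_sym by blast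
    moreover have "r \<noteq> t3"
      using r(1) s3(1) adj_sym[of s1 t3] s1(2) ts_ne(4) ss(3) by auto
    moreover have V: "r \<in> V" "t2 \<in> V" "t3 \<in> V"
      using r t adj_in_V by auto
    moreover have n: "(t2, r) \<notin> E" "(t3, r) \<notin> E" "(t1, r) \<notin> E"
      using calculation ne r(2) by (auto simp: T)
    obtain z where "(t2, z) \<in> E" "(r, z) \<in> E"
      using near[OF V(2,1)] \<open>r \<noteq> t2\<close> n(1) by metis
    then have "(r, s2) \<in> E"
      using n adj_sym by (auto simp: T(2))
    obtain z where "(t3, z) \<in> E" "(r, z) \<in> E"
      using near[OF V(3,1)] \<open>r \<noteq> t3\<close> n(2) by metis
    then have "(r, s3) \<in> E"
      using n adj_sym by (auto simp: T(3))
    with \<open>(r, s2) \<in> E\<close> ne \<open>r \<noteq> t2\<close> \<open>r \<noteq> t3\<close> show ?thesis by simp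
  qed
  have sr: "(s1, r1) \<in> E" "(s1, r2) \<in> E"
    by (simp_all add: adj_iff[OF r(1)])
  note a = adj[OF sr(1) r(2)] adj[OF sr(2) r(3)]
  \<comment> \<open>A triangle is matched to the larger side of a complete bipartite graph on 3 + 2
    vertices; the list is a Hamiltonian cycle in the numbering of \<open>H1\<close>.\<close>
  show ?thesis
    by (rule graph_copy_H1[of t1 t2 t3 s3 r1 s2 r2 s1])
      (use a r(2-4) ss ts_ne s1(2,3) s2(2,3) s3(2,3) t t' ts st sr adj_sym[of r1] adj_sym[of r2] adj_sym[of s1] in auto)
qed

section \<open>Girth at least 4\<close>

context
  assumes triangle_free: "\<forall>a b c. (a, b) \<in> E \<longrightarrow> (b, c) \<in> E \<longrightarrow> (c, a) \<notin> E"
begin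

lemma no_tri: "(a, b) \<in> E \<Longrightarrow> (b, c) \<in> E \<Longrightarrow> (c, a) \<in> E \<Longrightarrow> False"
  using triangle_free by blast

text \<open>\<open>s\<close> and \<open>y\<close> are not adjacent, so they have a common neighbour
  among \<open>v\<close>, \<open>z\<close>, \<open>t\<close>. The first two would close a triangle
  with \<open>x\<close>.\<close>

lemma third_neighbours_adjacent:
  assumes x: "N x = {v, z, s}" "s \<noteq> v" "s \<noteq> z" and y: "N y = {v, z, t}" "t \<noteq> v" "t \<noteq> z" and "s \<noteq> t"
  shows "(s, t) \<in> E"
proof -
  have e: "(x, v) \<in> E" "(x, z) \<in> E" "(x, s) \<in> E" "(y, v) \<in> E" "(y, z) \<in> E"
    using x(1) y(1) by auto
  have "s \<noteq> y"
    using e no_tri[of x y v] adj_sym[of x v] by auto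
  moreover have "(s, y) \<notin> E"
    using y x \<open>s \<noteq> t\<close> adj_sym[of s y] by auto
  ultimately obtain w where w: "(s, w) \<in> E" "(y, w) \<in> E"
    using near[of s y] adj_in_V(2)[OF e(3)] adj_in_V(1)[OF e(4)] by metis
  have "(s, v) \<notin> E" "(s, z) \<notin> E"
    using no_tri[OF e(3) _ adj_sym[OF e(1)]] no_tri[OF e(3) _ adj_sym[OF e(2)]] by auto
  then show ?thesis
    using w y(1) by auto
qed

text \<open>If \<open>s\<close> and \<open>t\<close> differ, they are adjacent, and the third
  neighbour \<open>w\<close> of \<open>t\<close> must share a neighbour with \<open>v\<close>. But
  the neighbours of \<open>x\<close>, \<open>y\<close>, \<open>u\<close> are all known, and
  \<open>w\<close> is none of them.\<close>

lemma third_neighbours_eq: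
  assumes v: "N v = {x, y, u}" "x \<noteq> y" "x \<noteq> u" "y \<noteq> u" and x: "N x = {v, z, s}" "s \<noteq> v" "s \<noteq> z"
    and y: "N y = {v, z, s}" and u: "N u = {v, z, t}" "t \<noteq> v" "t \<noteq> z"
  shows "s = t"
proof (rule ccontr)
  assume "s \<noteq> t"
  then have st: "(s, t) \<in> E"
    using third_neighbours_adjacent[OF x u] by simp
  note A = adj_iff[OF v(1)] adj_iff[OF x(1)] adj_iff[OF y(1)] adj_iff[OF u(1)]
  have e: "(v, x) \<in> E" "(v, y) \<in> E" "(v, u) \<in> E" "(u, t) \<in> E" "(u, z) \<in> E"
    by (simp_all add: A)
  have "(x, s) \<in> E"
    by (simp add: A)
  then have "u \<noteq> s"
    using no_tri[OF e(1) _ adj_sym[OF e(3)]] by blast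
  then obtain w where w: "N t = {u, s, w}" "w \<noteq> u" "w \<noteq> s"
    using nbrs_other1[OF adj_sym[OF e(4)] adj_sym[OF st]] by blast
  have tw: "(t, w) \<in> E"
    using w(1) by auto
  have "(v, t) \<notin> E"
    using no_tri[OF e(3,4)] adj_sym by blast
  then have "w \<noteq> v"
    using tw adj_sym by blast
  have nxt: "(x, t) \<notin> E" "(y, t) \<notin> E"
    using u(2,3) \<open>s \<noteq> t\<close> by (simp_all add: A)
  have "(v, w) \<notin> E"
    using tw w(2) nxt adj_sym by (auto simp: A(1))
  then have "(w, v) \<notin> E"
    using adj_sym by blast
  then obtain k where k: "(w, k) \<in> E" "(v, k) \<in> E"
    using near[OF adj_in_V(2)[OF tw] adj_in_V(1)[OF e(1)] \<open>w \<noteq> v\<close>] by blast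
  have "w \<noteq> z"
    using no_tri[OF e(4) tw] adj_sym[OF e(5)] by auto
  have "w \<noteq> t"
    using tw by auto
  have "(k, w) \<in> E" "k \<in> {x, y, u}"
    using k adj_sym by (simp_all add: A)
  then show False
    using \<open>w \<noteq> z\<close> \<open>w \<noteq> v\<close> \<open>w \<noteq> t\<close> w(3) by (auto simp: A)
qed

text \<open>The third neighbours of \<open>a\<close>, \<open>b\<close>, \<open>c\<close> cannot be
  pairwise distinct, as they would form a triangle; once two agree,
  \<open>third_neighbours_eq\<close> makes all three agree.\<close>

lemma graph_copy_K23:
  assumes v: "N v = {a, b, c}" "a \<noteq> b" "a \<noteq> c" "b \<noteq> c" and z: "N z = {a, b, c}" "v \<noteq> z"
  shows "graph_copy H2 V E"
proof -
  have e: "(v, a) \<in> E" "(v, b) \<in> E" "(v, c) \<in> E" "(z, a) \<in> E" "(z, b) \<in> E" "(z, c) \<in> E"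
    using v(1) z(1) by auto
  note e' = e[THEN adj_sym]
  obtain a' where a: "N a = {v, z, a'}" "a' \<noteq> v" "a' \<noteq> z"
    using nbrs_other1[OF e'(1,4) z(2)] .
  obtain b' where b: "N b = {v, z, b'}" "b' \<noteq> v" "b' \<noteq> z"
    using nbrs_other1[OF e'(2,5) z(2)] .
  obtain c' where c: "N c = {v, z, c'}" "c' \<noteq> v" "c' \<noteq> z"
    using nbrs_other1[OF e'(3,6) z(2)] .
  have "a' = b' \<or> b' = c' \<or> a' = c'"
    using third_neighbours_adjacent[OF a b] third_neighbours_adjacent[OF b c]
      third_neighbours_adjacent[OF c a] no_tri[of a' b' c'] by auto
  then have "a' = b' \<and> a' = c'"
  proof (elim disjE)
    assume "a' = b'"
    then show ?thesis
      using third_neighbours_eq[OF v a _ c] b(1) by simp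
  next
    assume "b' = c'"
    then show ?thesis
      using third_neighbours_eq[of v b c a z b' a'] v a b c by (simp add: insert_commute)
  next
    assume "a' = c'"
    then show ?thesis
      using third_neighbours_eq[of v a c b z a' b'] v a b c by (simp add: insert_commute)
  qed
  then have eq: "a' = b'" "a' = c'" by auto
  have e2: "(a, a') \<in> E" "(b, a') \<in> E" "(c, a') \<in> E"
    using a(1) b(1) c(1) eq by auto
  have "a \<noteq> v" "b \<noteq> v" "c \<noteq> v" "a \<noteq> z" "b \<noteq> z" "c \<noteq> z" "a' \<noteq> a" "a' \<noteq> b" "a' \<noteq> c"
    using e e2 by auto
  then show ?thesis
    by (intro graph_copy_H2[of v z a' a b c]) (use v z a(2,3) e e2[THEN adj_sym] in auto)
qed

lemma graph_copy_wagner: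
  assumes v: "N v = {a, b, c}" "a \<noteq> b" "c \<noteq> a" "c \<noteq> b" and z: "N z = {a, b, e}" "e \<noteq> a" "e \<noteq> b"
    and a: "N a = {v, z, f}" "v \<noteq> z" "f \<noteq> v" "f \<noteq> z" and b: "N b = {v, z, g}" "g \<noteq> v" "g \<noteq> z"
    and ce: "(c, e) \<in> E" and fg: "(f, g) \<in> E" and cf: "(c, f) \<in> E"
  shows "graph_copy H3 V E"
proof -
  have edges: "(v, a) \<in> E" "(v, b) \<in> E" "(v, c) \<in> E" "(z, a) \<in> E" "(z, b) \<in> E" "(z, e) \<in> E"
    "(a, f) \<in> E" "(b, g) \<in> E"
    using v(1) z(1) a(1) b(1) by auto
  note sym = edges[THEN adj_sym] ce[THEN adj_sym] fg[THEN adj_sym] cf[THEN adj_sym]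
  have "c \<noteq> e" "f \<noteq> g" "c \<noteq> f"
    using ce fg cf by auto
  have "v \<noteq> e"
    using no_tri[OF edges(1) sym(4)] edges(6) by blast
  have "e \<noteq> f"
    using no_tri[OF edges(4,7)] sym(6) by blast
  have "a \<noteq> g"
    using no_tri[OF edges(1) _ sym(2)] sym(8) by blast
  have "c \<noteq> g"
    using no_tri[OF edges(2,8)] sym(3) by blast
  have "e \<noteq> g"
    using no_tri[OF edges(5,8)] sym(6) by blast
  have "c \<noteq> z"
    using no_tri[OF edges(1) sym(4)] sym(3) by blast
  have Nc: "N c = {v, e, f}"
    by (rule N_subset3) (use ce cf sym \<open>v \<noteq> e\<close> \<open>e \<noteq> f\<close> a(3) in simp_all)
  have Nf: "N f = {a, g, c}"
    by (rule N_subset3) (use fg sym \<open>a \<noteq> g\<close> v(3) \<open>c \<noteq> g\<close> in simp_all)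
  note A = adj_iff[OF v(1)] adj_iff[OF z(1)] adj_iff[OF a(1)] adj_iff[OF b(1)] adj_iff[OF Nc] adj_iff[OF Nf]
  have "e \<noteq> z"
    using edges(6) by auto
  have "(e, g) \<in> E"
  \<comment> \<open>A common neighbour \<open>h\<close> of \<open>e\<close> and \<open>g\<close>
    would be a ninth vertex. All neighbours of \<open>a\<close>, \<open>b\<close>, \<open>c\<close>
    are accounted for, so \<open>h\<close> would be far from \<open>v\<close>.\<close>
  proof (rule ccontr)
    assume eg: "(e, g) \<notin> E"
    obtain h where h: "(e, h) \<in> E" "(g, h) \<in> E"
      using near[OF adj_in_V(2)[OF edges(6)] adj_in_V(2)[OF edges(8)] \<open>e \<noteq> g\<close> eg] .
    note h' = h[THEN adj_sym]
    have "h \<noteq> z"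
      using no_tri[OF edges(5,8)] h(2) by blast
    have "h \<noteq> a"
      using no_tri[OF edges(4) _ sym(6)] h'(1) by blast
    have "h \<noteq> b"
      using no_tri[OF edges(5) _ sym(6)] h'(1) by blast
    have "h \<noteq> c"
      using h'(2) b(2) \<open>e \<noteq> g\<close> \<open>f \<noteq> g\<close> by (auto simp: A)
    have "h \<noteq> f"
      using h'(1) z(2) \<open>e \<noteq> g\<close> \<open>c \<noteq> e\<close> by (auto simp: A)
    have "h \<noteq> e" "h \<noteq> g"
      using h by auto
    have "h \<noteq> v"
      using h'(1) z(2,3) \<open>c \<noteq> e\<close> by (auto simp: A)
    have "(v, h) \<notin> E"
      using \<open>h \<noteq> a\<close> \<open>h \<noteq> b\<close> \<open>h \<noteq> c\<close> by (simp add: A)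
    then obtain k where k: "(v, k) \<in> E" "(h, k) \<in> E"
      using near[OF adj_in_V(1)[OF edges(1)] adj_in_V(2)[OF h(1)] \<open>h \<noteq> v\<close>[symmetric]] by blast
    have "(k, h) \<in> E" "k \<in> {a, b, c}"
      using k(1) adj_sym[OF k(2)] by (simp_all add: A)
    then show False
      using \<open>h \<noteq> v\<close> \<open>h \<noteq> z\<close> \<open>h \<noteq> f\<close> \<open>h \<noteq> g\<close> \<open>h \<noteq> e\<close> by (auto simp: A)
  qed
  have "v \<noteq> a" "v \<noteq> b" "v \<noteq> c" "z \<noteq> a" "z \<noteq> b" "f \<noteq> a" "g \<noteq> b"
    using edges by auto
  have "b \<noteq> f"
    using no_tri[OF edges(1,7)] sym(2) by blast
  \<comment> \<open>The Wagner graph in cyclic order; its long chords are \<open>v\<close>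
    \<open>a\<close>, \<open>c\<close> \<open>f\<close>, \<open>e\<close> \<open>g\<close> and
    \<open>z\<close> \<open>b\<close>.\<close>
  have dist: "distinct [v, c, e, z, a, f, g, b]"
    using \<open>v \<noteq> a\<close> \<open>v \<noteq> b\<close> \<open>v \<noteq> c\<close> \<open>z \<noteq> a\<close> \<open>z \<noteq> b\<close> \<open>f \<noteq> a\<close> \<open>g \<noteq> b\<close> \<open>b \<noteq> f\<close> \<open>e \<noteq> z\<close> \<open>c \<noteq> z\<close>
      \<open>e \<noteq> g\<close>
      \<open>c \<noteq> g\<close> \<open>a \<noteq> g\<close> \<open>e \<noteq> f\<close> \<open>v \<noteq> e\<close> \<open>c \<noteq> e\<close> \<open>f \<noteq> g\<close> \<open>c \<noteq> f\<close> v(2-4) z(2,3) a(2-4) b(2,3) by auto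
  show ?thesis
    using graph_copy_H3[OF dist edges(3) ce sym(6) edges(4) edges(7) fg sym(8) sym(2) edges(1) cf \<open>(e, g) \<in> E\<close> edges(5)] .
qed

text \<open>Each vertex of the 4-cycle has a third neighbour, and those of opposite vertices are
  distinct by \<open>no_K23\<close>. Diameter 2 makes them adjacent and adds an edge between the two
  pairs. Up to the symmetries of the cycle this is the situation of
  \<open>graph_copy_wagner\<close>.\<close>

lemma graph_copy_4_cycle:
  assumes no_K23: "\<forall>v\<in>V. \<forall>z\<in>V. N v = N z \<longrightarrow> v = z"
    and e: "(v, a) \<in> E" "(a, z) \<in> E" "(z, b) \<in> E" "(b, v) \<in> E" "v \<noteq> z" "a \<noteq> b"
  shows "graph_copy H3 V E"
proof -
  note sym = e(1-4)[THEN adj_sym]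
  obtain c where v: "N v = {a, b, c}" "c \<noteq> a" "c \<noteq> b"
    using nbrs_other1[OF e(1) sym(4) e(6)] .
  obtain d where z: "N z = {a, b, d}" "d \<noteq> a" "d \<noteq> b"
    using nbrs_other1[OF sym(2) e(3) e(6)] .
  obtain f where a: "N a = {v, z, f}" "f \<noteq> v" "f \<noteq> z"
    using nbrs_other1[OF sym(1) e(2) e(5)] .
  obtain g where b: "N b = {v, z, g}" "g \<noteq> v" "g \<noteq> z"
    using nbrs_other1[OF e(4) sym(3) e(5)] .
  note A = adj_iff[OF v(1)] adj_iff[OF z(1)] adj_iff[OF a(1)] adj_iff[OF b(1)]
  have vc: "(v, c) \<in> E" "(z, d) \<in> E" "(a, f) \<in> E" "(b, g) \<in> E"
    by (simp_all add: A)
  note cv = vc[THEN adj_sym]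
  note inV = vc[THEN adj_in_V(1)] vc[THEN adj_in_V(2)]
  have "c \<noteq> d" "f \<noteq> g"
    using bspec[OF bspec[OF no_K23 inV(1)] inV(2)] bspec[OF bspec[OF no_K23 inV(3)] inV(4)]
      v(1) z(1) a(1) b(1) e(5,6) by auto
  have naf: "(a, g) \<notin> E"
    using \<open>f \<noteq> g\<close> b(2,3) by (simp add: A)
  have nvd: "(v, d) \<notin> E"
    using \<open>c \<noteq> d\<close> z(2,3) by (simp add: A)
  have "v \<noteq> d"
    using no_tri[OF e(1,2)] vc(2) by blast
  obtain t where t: "(v, t) \<in> E" "(d, t) \<in> E"
    using near[OF inV(1,6) \<open>v \<noteq> d\<close> nvd] .
  have "(t, d) \<in> E" "t \<noteq> a" "t \<noteq> b"
    using t(2) adj_sym[OF t(2)] no_tri[OF sym(2) _ cv(2)] no_tri[OF e(3) _ cv(2)] by blast+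
  then have cd: "(c, d) \<in> E"
    using t(1) by (simp add: A)
  have "a \<noteq> g"
    using no_tri[OF e(1) _ e(4)] cv(4) by blast
  obtain t where t: "(a, t) \<in> E" "(g, t) \<in> E"
    using near[OF inV(3,8) \<open>a \<noteq> g\<close> naf] .
  have "(t, g) \<in> E" "t \<noteq> v" "t \<noteq> z"
    using t(2) adj_sym[OF t(2)] no_tri[OF sym(4) vc(4)] no_tri[OF e(3) vc(4)] by blast+
  then have fg: "(f, g) \<in> E"
    using t(1) by (simp add: A)
  have "(c, f) \<in> E \<or> (c, g) \<in> E \<or> (d, f) \<in> E \<or> (d, g) \<in> E"
  proof (rule ccontr)
    assume none: "\<not> ?thesis"
    \<comment> \<open>\<open>k\<close> is the only neighbour of \<open>c\<close> that can also be
      adjacent to \<open>f\<close> or to \<open>g\<close>, so it would form a triangle with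
      them.\<close>
    obtain k where c: "N c = {v, d, k}"
      using nbrs_other1[OF cv(1) cd \<open>v \<noteq> d\<close>] .
    have kt: "t = k" if "(c, t) \<in> E" "(s, t) \<in> E" "(d, s) \<notin> E" "(v, s) \<notin> E" for s t
      using that adj_sym[of s t] by (auto simp: adj_iff[OF c])
    have "c \<noteq> f" "c \<noteq> g"
      using no_tri[OF e(1) vc(3)] no_tri[OF sym(4) vc(4)] cv(1) by blast+
    have nv: "(v, f) \<notin> E" "(v, g) \<notin> E"
      using no_tri[OF e(1) vc(3)] no_tri[OF sym(4) vc(4)] adj_sym by blast+
    obtain t where t: "(c, t) \<in> E" "(f, t) \<in> E"
      using near[OF inV(5,7) \<open>c \<noteq> f\<close>] none by blast
    obtain u where u: "(c, u) \<in> E" "(g, u) \<in> E"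
      using near[OF inV(5,8) \<open>c \<noteq> g\<close>] none by blast
    have "t = k" "u = k"
      using kt[OF t] kt[OF u] none nv by blast+
    then show False
      using no_tri[OF fg u(2)] adj_sym[OF t(2)] by simp
  qed
  then show ?thesis
  proof (elim disjE)
    assume "(c, f) \<in> E"
    then show ?thesis
      using graph_copy_wagner[OF v(1) e(6) v(2,3) z a(1) e(5) a(2,3) b cd fg] by simp
  next
    assume "(c, g) \<in> E"
    moreover have "N v = {b, a, c}" "N z = {b, a, d}"
      using v(1) z(1) by auto
    ultimately show ?thesis
      using graph_copy_wagner[of v b a c z d g f] v z a b e(5,6) cd adj_sym[OF fg] by simp
  next
    assume "(d, f) \<in> E"
    moreover have "N a = {z, v, f}" "N b = {z, v, g}"
      using a(1) b(1) by auto
    ultimately show ?thesis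
      using graph_copy_wagner[of z a b d v c f g] v z a b e(5,6) adj_sym[OF cd] fg by simp
  next
    assume "(d, g) \<in> E"
    moreover have "N a = {z, v, f}" "N b = {z, v, g}" "N v = {b, a, c}" "N z = {b, a, d}"
      using v(1) z(1) a(1) b(1) by auto
    ultimately show ?thesis
      using graph_copy_wagner[of z b a d v c g f] v z a b e(5,6) adj_sym[OF cd] adj_sym[OF fg] by simp
  qed
qed

text \<open>Without cycles of length 3 or 4, a vertex has six grandchildren. By diameter 2 each is
  adjacent to one below each other child, which makes them a 6-cycle with opposite vertices below
  the same child.\<close>

lemma graph_copy_petersen:
  assumes "\<forall>a b c d. (a, b) \<in> E \<longrightarrow> (b, c) \<in> E \<longrightarrow> (c, d) \<in> E \<longrightarrow> (d, a) \<in> E \<longrightarrow> a \<noteq> c \<longrightarrow> b = d"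
  shows "graph_copy H4 V E"
proof -
  have no_4: "b = d" if "(a, b) \<in> E" "(b, c) \<in> E" "(c, d) \<in> E" "(d, a) \<in> E" "a \<noteq> c" for a b c d
    using assms that by blast
  obtain x where "x \<in> V"
    using V_nonempty by auto
  then obtain a1 a2 a3 where x: "N x = {a1, a2, a3}" "a1 \<noteq> a2" "a1 \<noteq> a3" "a2 \<noteq> a3"
    using cubic[of x] by (auto simp: card_3_iff)
  have xa: "(x, a1) \<in> E" "(x, a2) \<in> E" "(x, a3) \<in> E"
    using x(1) by auto
  note ax = xa[THEN adj_sym]
  have across: "(a, c) \<notin> E \<and> (c, a) \<notin> E \<and> a \<noteq> c"
    if "(x, a) \<in> E" "(x, a') \<in> E" "(a', c) \<in> E" "x \<noteq> c" "a \<noteq> a'" for a a' c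
    using no_4[OF that(1) _ adj_sym[OF that(3)] adj_sym[OF that(2)] that(4)] that(5) adj_sym[of c a]
      no_tri[OF that(2) _ adj_sym[OF that(1)]] that(3) by blast
  have opp: "(c, d) \<in> E \<or> (c, d') \<in> E"
    if a: "(x, a) \<in> E" "(x, a') \<in> E" "(a', c) \<in> E" "x \<noteq> c" "a \<noteq> a'" and N: "N a = {x, d, d'}" for a a' c d d'
  proof -
    obtain t where t: "(a, t) \<in> E" "(c, t) \<in> E"
      using near[OF adj_in_V(2)[OF a(1)] adj_in_V(2)[OF a(3)]] across[OF a] by blast
    then have "t \<noteq> x"
      using no_tri[OF a(2,3)] by blast
    then show ?thesis
      using t by (auto simp: adj_iff[OF N])
  qed
  obtain c11 c12 where c1: "N a1 = {x, c11, c12}" "x \<noteq> c11" "x \<noteq> c12" "c11 \<noteq> c12"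
    using nbrs_other2[OF ax(1)] .
  have ac1: "(a1, c11) \<in> E" "(a1, c12) \<in> E"
    using c1(1) by auto
  obtain c21 c22 where c2: "N a2 = {x, c21, c22}" "x \<noteq> c21" "x \<noteq> c22" "c21 \<noteq> c22" "(c11, c21) \<in> E"
  proof -
    obtain d d' where d: "N a2 = {x, d, d'}" "x \<noteq> d" "x \<noteq> d'" "d \<noteq> d'"
      using nbrs_other2[OF ax(2)] .
    moreover have "N a2 = {x, d', d}"
      using d(1) by auto
    ultimately show ?thesis
      using that[of d d'] that[of d' d] opp[OF xa(2,1) ac1(1) c1(2) x(2)[symmetric] d(1)] by blast
  qed
  obtain c31 c32 where c3: "N a3 = {x, c31, c32}" "x \<noteq> c31" "x \<noteq> c32" "c31 \<noteq> c32" "(c11, c31) \<in> E"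
  proof -
    obtain d d' where d: "N a3 = {x, d, d'}" "x \<noteq> d" "x \<noteq> d'" "d \<noteq> d'"
      using nbrs_other2[OF ax(3)] .
    moreover have "N a3 = {x, d', d}"
      using d(1) by auto
    ultimately show ?thesis
      using that[of d d'] that[of d' d] opp[OF xa(3,1) ac1(1) c1(2) x(3)[symmetric] d(1)] by blast
  qed
  have ac2: "(a2, c21) \<in> E" "(a2, c22) \<in> E" and ac3: "(a3, c31) \<in> E" "(a3, c32) \<in> E"
    using c2(1) c3(1) by auto
  note across' = across[OF xa(1,2) ac2(1) c2(2) x(2)] across[OF xa(1,2) ac2(2) c2(3) x(2)]
    across[OF xa(1,3) ac3(1) c3(2) x(3)] across[OF xa(1,3) ac3(2) c3(3) x(3)]
    across[OF xa(2,1) ac1(1) c1(2) x(2)[symmetric]] across[OF xa(2,1) ac1(2) c1(3) x(2)[symmetric]]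
    across[OF xa(2,3) ac3(1) c3(2) x(4)] across[OF xa(2,3) ac3(2) c3(3) x(4)]
    across[OF xa(3,1) ac1(1) c1(2) x(3)[symmetric]] across[OF xa(3,1) ac1(2) c1(3) x(3)[symmetric]]
    across[OF xa(3,2) ac2(1) c2(2) x(4)[symmetric]] across[OF xa(3,2) ac2(2) c2(3) x(4)[symmetric]]
  have "(c12, c21) \<notin> E" "(c12, c31) \<notin> E"
    using no_4[OF c2(5) adj_sym adj_sym[OF ac1(2)] ac1(1) c1(4)]
      no_4[OF c3(5) adj_sym adj_sym[OF ac1(2)] ac1(1) c1(4)] across' by blast+
  then have c12: "(c12, c22) \<in> E" "(c12, c32) \<in> E"
    using opp[OF xa(2,1) ac1(2) c1(3) x(2)[symmetric] c2(1)] opp[OF xa(3,1) ac1(2) c1(3) x(3)[symmetric] c3(1)]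
    by blast+
  have "(c21, c31) \<notin> E"
    using no_tri[OF c2(5) _ adj_sym[OF c3(5)]] by blast
  then have c21: "(c21, c32) \<in> E"
    using opp[OF xa(3,2) ac2(1) c2(2) x(4)[symmetric] c3(1)] by blast
  have "(c22, c32) \<notin> E"
    using no_tri[OF c12(1) _ adj_sym[OF c12(2)]] by blast
  then have c22: "(c22, c31) \<in> E"
    using opp[OF xa(3,2) ac2(2) c2(3) x(4)[symmetric] c3(1)] by blast
  have "c11 \<noteq> c21" "c11 \<noteq> c22" "c11 \<noteq> c31" "c11 \<noteq> c32" "c12 \<noteq> c21" "c12 \<noteq> c22" "c12 \<noteq> c31" "c12 \<noteq> c32"
    "c21 \<noteq> c31" "c21 \<noteq> c32" "c22 \<noteq> c31" "c22 \<noteq> c32"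
    using across' ac1 ac2 ac3 by blast+
  moreover have "x \<noteq> a1" "x \<noteq> a2" "x \<noteq> a3" "a1 \<noteq> c11" "a1 \<noteq> c12" "a2 \<noteq> c21" "a2 \<noteq> c22" "a3 \<noteq> c31" "a3 \<noteq> c32"
    using xa ac1 ac2 ac3 by auto
  \<comment> \<open>The first five vertices form the outer cycle and the last five are their
    partners on the inner one, in the numbering of \<open>H4\<close>.\<close>
  ultimately have "distinct [x, a1, c11, c21, a2, a3, c12, c31, c32, c22]"
    using x c1(2-4) c2(2-4) c3(2-4) across' by auto
  then show ?thesis
    using graph_copy_H4[of x a1 c11 c21 a2 a3 c12 c31 c32 c22] xa(1) ac1(1) c2(5) adj_sym[OF ac2(1)] ax(2)
      xa(3) ac1(2) c3(5) c21 ac2(2) ac3(1) c12(2) adj_sym[OF c22] adj_sym[OF ac3(2)] adj_sym[OF c12(1)] by simp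
qed

end

lemma classification:
  "graph_copy H1 V E \<or> graph_copy H2 V E \<or> graph_copy H3 V E \<or> graph_copy H4 V E"
proof (cases "\<exists>a b c. (a, b) \<in> E \<and> (b, c) \<in> E \<and> (c, a) \<in> E")
  case True
  then show ?thesis
    using graph_copy_triangle by blast
next
  case False
  then have triangle_free: "\<forall>a b c. (a, b) \<in> E \<longrightarrow> (b, c) \<in> E \<longrightarrow> (c, a) \<notin> E"
    by blast
  show ?thesis
  \<comment> \<open>Equal neighbourhoods occur in \<open>H2\<close> but not in the Wagner graph, so
    this separates the two outcomes of girth 4.\<close>
  proof (cases "\<forall>v\<in>V. \<forall>z\<in>V. N v = N z \<longrightarrow> v = z")
    case False
    then obtain v z where vz: "v \<in> V" "v \<noteq> z" "N v = N z"
      by blast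
    then obtain a b c where "N v = {a, b, c}" "a \<noteq> b" "a \<noteq> c" "b \<noteq> c"
      using cubic[of v] by (auto simp: card_3_iff)
    then show ?thesis
      using graph_copy_K23[OF triangle_free, of v a b c z] vz by simp
  next
    case no_K23: True
    show ?thesis
    proof (cases "\<exists>a b c d. (a, b) \<in> E \<and> (b, c) \<in> E \<and> (c, d) \<in> E \<and> (d, a) \<in> E \<and> a \<noteq> c \<and> b \<noteq> d")
      case True
      then obtain a b c d where "(a, b) \<in> E" "(b, c) \<in> E" "(c, d) \<in> E" "(d, a) \<in> E" "a \<noteq> c" "b \<noteq> d"
        by blast
      then show ?thesis
        using graph_copy_4_cycle[OF triangle_free no_K23, of a b c d] by simp
    next
      case False
      then have "\<forall>a b c d. (a, b) \<in> E \<longrightarrow> (b, c) \<in> E \<longrightarrow> (c, d) \<in> E \<longrightarrow> (d, a) \<in> E \<longrightarrow> a \<noteq> c \<longrightarrow> b = d"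
        by blast
      then show ?thesis
        using graph_copy_petersen[OF triangle_free] by simp
    qed
  qed
qed

end

section \<open>The characterization\<close>

lemma diameter_two_cubic_copy:
  assumes copy: "graph_copy H V E" and "pair_wf_digraph H"
    and d: "diameter_two_cubic (pverts H) (parcs H)"
  shows "diameter_two_cubic V E"
proof -
  have H: "parcs H \<subseteq> pverts H \<times> pverts H"
    using pair_wf_digraph.in_arcsD1[OF assms(2)] pair_wf_digraph.in_arcsD2[OF assms(2)] by auto
  obtain g where g: "inj_on g (pverts H)" "V = g ` pverts H" "E = map_prod g g ` parcs H"
    using copy by (auto simp: graph_copy_def)
  have N: "E `` {g u} = g ` (parcs H `` {u})" if "u \<in> pverts H" for u
  proof (intro equalityI subsetI)
    fix w assume "w \<in> E `` {g u}"
    then obtain a b where ab: "(a, b) \<in> parcs H" "g u = g a" "w = g b"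
      using g(3) by auto
    then have "a = u"
      using g(1) that H by (auto dest: inj_onD)
    then show "w \<in> g ` (parcs H `` {u})"
      using ab by auto
  next
    fix w assume "w \<in> g ` (parcs H `` {u})"
    then show "w \<in> E `` {g u}"
      using g(3) by force
  qed
  have sub: "parcs H `` {u} \<subseteq> pverts H" for u
    using H by auto
  have card_image': "card (g ` A) = card A" if "A \<subseteq> pverts H" for A
    using g(1) that by (meson card_image inj_on_subset)
  show ?thesis
    unfolding diameter_two_cubic_def
  proof (intro conjI ballI impI)
    show "4 < card V"
      using d card_image'[of "pverts H"] g(2) by (simp add: diameter_two_cubic_def)
  next
    fix u assume "u \<in> V"
    then obtain u' where u: "u' \<in> pverts H" "u = g u'"
      using g(2) by auto
    show "card (E `` {u}) = 3"
      using d u card_image'[OF sub] N by (simp add: diameter_two_cubic_def)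
    fix v assume "v \<in> V"
    then obtain v' where v: "v' \<in> pverts H" "v = g v'"
      using g(2) by auto
    have "\<not> far (parcs H) u' v'"
      using d u(1) v(1) by (simp add: diameter_two_cubic_def)
    then show "\<not> far E u v"
      unfolding far_iff u(2) v(2) N[OF u(1)] N[OF v(1)] by auto
    assume "u \<noteq> v" "v \<notin> E `` {u}"
    then have "u' \<noteq> v'" "v' \<notin> parcs H `` {u'}"
      using u v N[OF u(1)] by auto
    then have "card (parcs H `` {u'} \<union> parcs H `` {v'}) + 2 < card (pverts H)"
      using d u(1) v(1) unfolding diameter_two_cubic_def by blast
    moreover have "card (E `` {u} \<union> E `` {v}) = card (parcs H `` {u'} \<union> parcs H `` {v'})"
      unfolding u(2) v(2) N[OF u(1)] N[OF v(1)] image_Un[symmetric]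
      by (rule card_image') (use sub in blast)
    ultimately show "card (E `` {u} \<union> E `` {v}) + 2 < card V"
      using card_image'[of "pverts H"] g(2) by simp
  qed
qed

section \<open>Packing and independent domination numbers of the four graphs\<close>

context subcubic_graph
begin

context
  assumes diam: "diameter_two_cubic V E"
begin

lemma card_pack_le_1:
  assumes "pack P"
  shows "card P \<le> 1"
proof -
  have "p = q" if "p \<in> P" "q \<in> P" for p q
    using pack_far[OF assms that] assms that diam
    unfolding diameter_two_cubic_def pack_def by blast
  then show ?thesis
    using card_le_Suc0_iff_eq[OF pack_finite[OF assms]] by auto
qed

lemma card_indep_dom_ge_3:
  assumes D: "indep_dom D"
  shows "3 \<le> card D"
proof (rule ccontr)
  assume "\<not> 3 \<le> card D"
  have V: "V = D \<union> E `` D"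
    using D Image_subset by (auto simp: indep_dom_def)
  have DV: "D \<subseteq> V" "finite D"
    using D finite_V finite_subset by (auto simp: indep_dom_def)
  have V4: "4 < card V"
    using diam by (simp add: diameter_two_cubic_def)
  consider "card D = 0" | "card D = 1" | "card D = 2"
    using \<open>\<not> 3 \<le> card D\<close> by linarith
  then show False
  proof cases
    case 1
    then show False
      using V V4 DV by auto
  next
    case 2
    then obtain u where u: "D = {u}"
      by (auto simp: card_1_singleton_iff)
    have "card V \<le> card {u} + card (N u)"
      unfolding V u by (rule card_Un_le)
    then show False
      using V4 degree_le[of u] by simp
  next
    case 3
    then obtain u v where uv: "D = {u, v}" "u \<noteq> v"
      by (auto simp: card_2_iff)
    have "v \<notin> N u" "u \<in> V" "v \<in> V"
      using D uv by (auto simp: indep_dom_def)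
    then have "card (N u \<union> N v) + 2 < card V"
      using diam uv(2) unfolding diameter_two_cubic_def by blast
    moreover have "E `` D = N u \<union> N v"
      using uv(1) by auto
    moreover have "card (D \<union> E `` D) \<le> card D + card (E `` D)"
      by (rule card_Un_le)
    ultimately show False
      using V 3 by simp
  qed
qed

text \<open>\<open>indep_dom_of_pack\<close> is used with the packing {\<open>v\<close>} and
  \<open>T\<close> a single neighbour of \<open>v\<close>. Then \<open>v\<close> is dominated, and
  \<open>I\<close> and \<open>X\<close> are disjoint parts of \<open>N v\<close>.\<close>

lemma ex_indep_dom_card_le_3: "\<exists>D. indep_dom D \<and> card D \<le> 3"
proof -
  obtain v where v: "v \<in> V"
    using diam by (cases "V = {}") (auto simp: diameter_two_cubic_def)
  then have "card (N v) = 3"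
    using diam by (simp add: diameter_two_cubic_def)
  then obtain x where x: "x \<in> N v"
    by (metis card.empty all_not_in_conv zero_neq_numeral)
  have "maximal_pack {v}"
    using v diam unfolding maximal_pack_def pack_def diameter_two_cubic_def by simp
  moreover have "{x} \<subseteq> E `` {v}" "E `` {x} \<inter> {x} = {}"
    using x by auto
  ultimately obtain D I X where D: "indep_dom D" "{x} \<subseteq> I" "I \<subseteq> E `` {v}" "E `` I \<inter> I = {}"
    "X \<subseteq> E `` {v} - I" "card D \<le> card I + card X + card ({v} - E `` I)"
    by (rule indep_dom_of_pack)
  have "v \<in> E `` I"
    using D(2) adj_sym x by auto
  then have "{v} - E `` I = {}"
    by auto
  moreover have "card I + card X = card (I \<union> X)"
    by (rule card_Un_disjoint[symmetric]) (use D(3,5) finite_subset[OF _ finite_N] in blast)+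
  moreover have "card (I \<union> X) \<le> card (N v)"
    by (rule card_mono) (use D(3,5) in auto)
  ultimately show ?thesis
    using D(1,6) \<open>card (N v) = 3\<close> by (metis add.right_neutral card.empty order_trans)
qed

end

end

section \<open>Translation from the digraph library\<close>

lemma subcubic_graph_of_pair_graph:
  assumes "pair_graph G" "subcubic G"
  shows "subcubic_graph (pverts G) (parcs G)"
proof -
  interpret pair_graph G by fact
  show ?thesis
  proof
    show "finite (pverts G)"
      by (rule pair_finite_verts)
    show sub: "parcs G \<subseteq> pverts G \<times> pverts G"
      by (auto dest: in_arcsD1 in_arcsD2)
    show "sym (parcs G)"
      using pair_sym_arcs by (simp add: symmetric_def)
    show "irrefl (parcs G)"
      using no_loops' by (auto simp: irrefl_def)
    show "card (parcs G `` {v}) \<le> 3" for v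
    proof (cases "v \<in> pverts G")
      case True
      have "out_arcs (with_proj G) v = Pair v ` (parcs G `` {v})"
        by (auto simp: out_arcs_def)
      then have "out_degree (with_proj G) v = card (parcs G `` {v})"
        by (simp add: out_degree_def card_image inj_on_def)
      then show ?thesis
        using assms(2) True unfolding subcubic_def by metis
    next
      case False
      then have "parcs G `` {v} = {}"
        using sub by auto
      then show ?thesis by simp
    qed
  qed
qed

lemma connected_closed_set:
  assumes "pair_graph G" "connected (with_proj G)"
    and S: "S \<subseteq> pverts G" "S \<noteq> {}" "parcs G `` S \<subseteq> S"
  shows "S = pverts G"
proof -
  interpret pair_graph G by fact
  have sc: "strongly_connected (with_proj G)"
    using symmetric_connected_imp_strongly_connected[OF pair_sym_arcs assms(2)] .
  have reach: "(u, v) \<in> (parcs G)\<^sup>*" if "u \<in> pverts G" "v \<in> pverts G" for u v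
    by (rule rtrancl_on_rtranclI[where F = "pverts G"]) (use sc that in \<open>simp add: strongly_connected_def reachable_def\<close>)
  obtain s where "s \<in> S"
    using S(2) by auto
  have "(parcs G)\<^sup>* `` S = S"
    using S(3) by (rule Image_closed_trancl)
  then have "v \<in> S" if "v \<in> pverts G" for v
    using reach[of s v] \<open>s \<in> S\<close> S(1) that by blast
  then show ?thesis
    using S(1) by blast
qed

text \<open>The distance is the infimum of the lengths of walks. It is at least 3 exactly if no walk
  has length 0, 1 or 2, and these lengths match the three clauses of \<open>far\<close>.\<close>

lemma three_le_distance_iff:
  assumes "pair_graph G" "u \<in> pverts G" "v \<in> pverts G"
  shows "3 \<le> distance G u v \<longleftrightarrow> far (parcs G) u v"
proof -
  interpret pair_graph G by fact
  have cost: "awalk_cost (\<lambda>_. 1) p = length p" for p :: "('a \<times> 'a) list"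
    by (induction p) auto
  have "3 \<le> distance G u v \<longleftrightarrow> (\<forall>p. awalk u p v \<longrightarrow> (3 :: ereal) \<le> ereal (length p))"
    unfolding distance_def \<mu>_def by (simp add: le_INF_iff cost)
  also have "\<dots> \<longleftrightarrow> (\<forall>p. awalk u p v \<longrightarrow> 3 \<le> length p)"
  proof -
    have "(3 :: ereal) = ereal (real 3)"
      by simp
    then show ?thesis
      by (simp only: ereal_less_eq of_nat_le_iff)
  qed
  also have "\<dots> \<longleftrightarrow> far (parcs G) u v"
  proof
    assume long: "\<forall>p. awalk u p v \<longrightarrow> 3 \<le> length p"
    show "far (parcs G) u v"
      unfolding far_def
    proof (intro conjI)
      show "u \<noteq> v"
        using long[rule_format, of "[]"] assms(2) by (auto simp: awalk_Nil_iff)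
      show "(u, v) \<notin> parcs G"
        using long[rule_format, of "[(u, v)]"] assms(3) by (auto simp: awalk_simps)
      show "parcs G `` {u} \<inter> parcs G `` {v} = {}"
      proof (rule ccontr)
        assume "parcs G `` {u} \<inter> parcs G `` {v} \<noteq> {}"
        then obtain z where "(u, z) \<in> parcs G" "(v, z) \<in> parcs G"
          by auto
        moreover have "(z, v) \<in> parcs G"
          using calculation(2) pair_sym_arcs by (auto simp: symmetric_def dest: symD)
        ultimately show False
          using long[rule_format, of "[(u, z), (z, v)]"] assms(3) by (auto simp: awalk_simps)
      qed
    qed
  next
    assume far: "far (parcs G) u v"
    show "\<forall>p. awalk u p v \<longrightarrow> 3 \<le> length p"
    proof (intro allI impI, rule ccontr)
      fix p assume p: "awalk u p v" "\<not> 3 \<le> length p"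
      then consider "p = []" | e where "p = [e]" | e e' where "p = [e, e']"
        by (cases p rule: remdups_adj.cases) (auto simp: Suc_le_eq numeral_3_eq_3)
      then show False
      proof cases
        case 1
        then show False
          using p far by (auto simp: awalk_simps far_def)
      next
        case 2
        then show False
          using p far by (auto simp: awalk_simps far_def)
      next
        case 3
        then obtain z where z: "(u, z) \<in> parcs G" "(z, v) \<in> parcs G"
          using p by (cases e; cases e') (auto simp: awalk_simps)
        then have "(v, z) \<in> parcs G"
          using pair_sym_arcs by (auto simp: symmetric_def dest: symD)
        then show False
          using z(1) far by (auto simp: far_def)
      qed
    qed
  qed
  finally show ?thesis .
qed

lemma pair_graph_H2: "pair_graph H2"
  unfolding H2_def by (rule pair_graph_undirected) (auto simp: irrefl_def)

text \<open>An isomorphism of the library also maps arcs, heads and tails. Between pair digraphs the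
  arcs are pairs of vertices, so the vertex map determines the rest.\<close>

lemma digraph_iso_iff_graph_copy:
  assumes G: "pair_wf_digraph G" and H: "pair_wf_digraph H"
  shows "digraph_iso (with_proj G) (with_proj H) \<longleftrightarrow> graph_copy H (pverts G) (parcs G)"
proof
  interpret H: pair_wf_digraph H by fact
  have wf: "wf_digraph (with_proj G)" "wf_digraph (with_proj H)"
    using G H by (simp_all add: wf_digraph_wp_iff)
  assume "digraph_iso (with_proj G) (with_proj H)"
  then obtain f where f: "pre_digraph.digraph_isomorphism (with_proj H) f"
    "with_proj G = app_iso f (with_proj H)"
    using digraph_iso_swap[OF wf(1)] by (auto simp: digraph_iso_def)
  have "pverts G = iso_verts f ` pverts H"
    using arg_cong[OF f(2), of verts] by simp
  moreover have "parcs G = map_prod (iso_verts f) (iso_verts f) ` parcs H"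
    using arg_cong[OF f(2), of arcs_ends] wf_digraph.arcs_ends_app_iso_eq[OF wf(2) f(1)]
    by (simp add: map_prod_def)
  moreover have "inj_on (iso_verts f) (pverts H)"
    using pre_digraph.digraph_isomorphism_inj_on_verts[OF f(1)] by simp
  ultimately show "graph_copy H (pverts G) (parcs G)"
    by (auto simp: graph_copy_def)
next
  have wf: "wf_digraph (with_proj G)" "wf_digraph (with_proj H)"
    using G H by (simp_all add: wf_digraph_wp_iff)
  assume "graph_copy H (pverts G) (parcs G)"
  then obtain g where g: "inj_on g (pverts H)" "pverts G = g ` pverts H" "parcs G = map_prod g g ` parcs H"
    by (auto simp: graph_copy_def)
  define f where "f = \<lparr>iso_verts = g, iso_arcs = map_prod g g, iso_head = snd, iso_tail = fst\<rparr>"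
  have "parcs H \<subseteq> pverts H \<times> pverts H"
    using pair_wf_digraph.in_arcsD1[OF H] pair_wf_digraph.in_arcsD2[OF H] by auto
  then have "inj_on (map_prod g g) (parcs H)"
    using map_prod_inj_on[OF g(1) g(1)] inj_on_subset by blast
  then have "pre_digraph.digraph_isomorphism (with_proj H) f"
    using g(1) wf(2) by (auto simp: pre_digraph.digraph_isomorphism_def f_def)
  moreover have "with_proj G = app_iso f (with_proj H)"
    using g by (simp add: with_proj_def app_iso_def f_def)
  ultimately have "digraph_iso (with_proj H) (with_proj G)"
    by (auto simp: digraph_iso_def)
  then show "digraph_iso (with_proj G) (with_proj H)"
    by (rule digraph_iso_swap[OF wf(2)])
qed

theorem theorem3:
  fixes G :: "'a pair_pre_digraph"
  assumes "pair_graph G" and "connected (with_proj G)" and "subcubic G"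
  shows "independent_domination_number G = 3 * packing_number G \<longleftrightarrow>
    digraph_iso (with_proj G) (with_proj H1) \<or>
    digraph_iso (with_proj G) (with_proj H2) \<or>
    digraph_iso (with_proj G) (with_proj H3) \<or>
    digraph_iso (with_proj G) (with_proj H4)"
proof -
  interpret G: pair_graph G by fact
  interpret subcubic_graph "pverts G" "parcs G"
    using assms(1,3) by (rule subcubic_graph_of_pair_graph)
  have pack_iff: "packing G S \<longleftrightarrow> pack S" for S
    unfolding packing_def pack_def pairwise_def
    using three_le_distance_iff[OF assms(1)] by blast
  have dom_iff: "independent_dominating_set G S \<longleftrightarrow> indep_dom S" for S
  proof -
    have "pairwise (\<lambda>u v. (u, v) \<notin> parcs G) S \<longleftrightarrow> parcs G `` S \<inter> S = {}"
      using adj_irrefl by (fastforce simp: pairwise_def)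
    moreover have "(\<forall>v\<in>pverts G. v \<in> S \<or> (\<exists>u\<in>S. (u, v) \<in> parcs G)) \<longleftrightarrow> pverts G \<subseteq> S \<union> parcs G `` S"
      by auto
    ultimately show ?thesis
      by (simp add: independent_dominating_set_def indep_dom_def)
  qed
  let ?i = "independent_domination_number G" and ?r = "packing_number G"
  have fin: "finite {S. indep_dom S}" "finite {S. pack S}"
    by (rule finite_subset[of _ "Pow (pverts G)"]; use finite_V in \<open>auto simp: indep_dom_def pack_def\<close>)+
  have i: "?i = Min (card ` {S. indep_dom S})" and r: "?r = Max (card ` {S. pack S})"
    by (simp_all add: independent_domination_number_def packing_number_def pack_iff dom_iff)
  have Hs: "pair_wf_digraph H1" "pair_wf_digraph H2" "pair_wf_digraph H3" "pair_wf_digraph H4"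
    using pair_graph_H1 pair_graph_H2 pair_graph_H3 pair_graph_H4
    by (simp_all add: pair_graph_def pair_digraph.pair_wf_digraph)
  note iso = Hs[THEN digraph_iso_iff_graph_copy[OF G.pair_wf_digraph]]
  show ?thesis
    unfolding iso
  proof
    assume eq: "?i = 3 * ?r"
    \<comment> \<open>The equality turns the minimum over independent dominating sets into the lower
      bound by \<open>3 * ?r\<close>.\<close>
    interpret tight_graph "pverts G" "parcs G" ?r
    proof
      show "pverts G \<noteq> {}"
        using assms(2) by (simp add: connected_conv)
      show "S = pverts G" if "S \<subseteq> pverts G" "S \<noteq> {}" "parcs G `` S \<subseteq> S" for S
        using connected_closed_set[OF assms(1,2) that] .
      show "3 * ?r \<le> card D" if "indep_dom D" for D
        unfolding eq[symmetric] i using that fin by (intro Min_le) auto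
      show "card P \<le> ?r" if "pack P" for P
        unfolding r using that fin by (intro Max_ge) auto
    qed
    show "graph_copy H1 (pverts G) (parcs G) \<or> graph_copy H2 (pverts G) (parcs G) \<or>
      graph_copy H3 (pverts G) (parcs G) \<or> graph_copy H4 (pverts G) (parcs G)"
      by (rule classification)
  next
    assume "graph_copy H1 (pverts G) (parcs G) \<or> graph_copy H2 (pverts G) (parcs G) \<or>
      graph_copy H3 (pverts G) (parcs G) \<or> graph_copy H4 (pverts G) (parcs G)"
    then have d: "diameter_two_cubic (pverts G) (parcs G)"
      using diameter_two_cubic_copy[OF _ Hs(1) diameter_two_cubic_H1]
        diameter_two_cubic_copy[OF _ Hs(2) diameter_two_cubic_H2]
        diameter_two_cubic_copy[OF _ Hs(3) diameter_two_cubic_H3]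
        diameter_two_cubic_copy[OF _ Hs(4) diameter_two_cubic_H4] by blast
    obtain D where D: "indep_dom D" "card D \<le> 3"
      using ex_indep_dom_card_le_3[OF d] by blast
    then have "card D = 3"
      using card_indep_dom_ge_3[OF d D(1)] by simp
    then have "?i = 3"
      unfolding i using D(1) card_indep_dom_ge_3[OF d] fin by (intro Min_eqI) auto
    moreover obtain v where "v \<in> pverts G"
      using d by (cases "pverts G = {}") (auto simp: diameter_two_cubic_def)
    then have "pack {v}"
      by (simp add: pack_def)
    then have "?r = 1"
      unfolding r using card_pack_le_1[OF d] fin
      by (intro Max_eqI) (auto intro!: image_eqI[of _ _ "{v}"])
    ultimately show "?i = 3 * ?r"
      by simp
  qed
qed

end
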